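(* Let $\zeta$ be a uniform binary substitution. Then for every $y\in X_\zeta$ and every $m,\ell\in\mathbb N$, \[ \lim_{\varepsilon\to0}\mathrm{DET}_\ell(y^{(m)},\infty,\varepsilon)=1 . \]
   Context: Alphabet $A=\{0,1\}$, $\Sigma=A^{\mathbb N_0}$ with metric $\rho(y,z)=2^{-\min\{i\ge0:\,y_i\ne z_i\}}$ ($y\ne z$), shift $\sigma$. A uniform binary substitution is a map $\zeta:A\to A^*$ with $|\zeta(0)|=|\zeta(1)|=q\ge2$, extended to words by concatenation; $\mathcal L_\zeta$ is the set of subwords of words $\zeta^k(a)$, $a\in A$, $k\ge1$; $X_\zeta=\{y\in\Sigma:y_0\dots y_{n-1}\in\mathcal L_\zeta\ \forall n\}$. For a sequence $z$ (over a finite alphabet, analogous metric and shift), $\varepsilon>0$, $n\ge2$: recurrence plot $R(z,n,\varepsilon)$ is the $n\times n$ matrix ($0\le i,j<n$) with entry $1$ iff $\rho(\sigma^iz,\sigma^jz)\le\varepsilon$. A line of length $\ell$ is $(i,j,\ell)$ with $0\le i,j\le n-\ell$, $i\ne j$, entries $(i+k,j+k)=1$ for $0\le k<\ell$, entry $(i-1,j-1)=0$ if $\min\{i,j\}>0$, entry $(i+\ell,j+\ell)=0$ if $\max\{i,j\}<n-\ell$. $N_\ell$ = number of lines of length exactly $\ell$, $\lambda_\ell=N_\ell/(n^2-n)$, $\mathrm{RR}_\ell=\sum_{l\ge\ell}l\lambda_l$, determinism $\mathrm{DET}_\ell=\mathrm{RR}_\ell/\mathrm{RR}_1$; $\mathrm{DET}_\ell(z,\infty,\varepsilon)$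 is the limit as $n\to\infty$ (it exists in the situation of the claim). Embedding: $y^{(m)}$ is the sequence over $A^m$ whose $j$-th letter is $y_j\dots y_{j+m-1}$. *)

theory Defs
  imports Complex_Main "HOL-Library.Sublist"
begin

text \<open>Binary alphabet A = {0,1} is rendered as bool. One-sided sequences are
  functions nat => 'a.\<close>

definition uniform_binary_subst :: "(bool \<Rightarrow> bool list) \<Rightarrow> nat \<Rightarrow> bool" where
  "uniform_binary_subst \<zeta> q \<longleftrightarrow> q \<ge> 2 \<and> length (\<zeta> False) = q \<and> length (\<zeta> True) = q"

definition subst_word :: "(bool \<Rightarrow> bool list) \<Rightarrow> bool list \<Rightarrow> bool list" where
  "subst_word \<zeta> w = concat (map \<zeta> w)"

definition subst_lang :: "(bool \<Rightarrow> bool list) \<Rightarrow> bool list set" where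
  "subst_lang \<zeta> = {w. \<exists>a k. k \<ge> 1 \<and> sublist w ((subst_word \<zeta> ^^ k) [a])}"

definition subst_shift_space :: "(bool \<Rightarrow> bool list) \<Rightarrow> (nat \<Rightarrow> bool) set" where
  "subst_shift_space \<zeta> = {y. \<forall>n. map y [0..<n] \<in> subst_lang \<zeta>}"

definition embed :: "nat \<Rightarrow> (nat \<Rightarrow> 'a) \<Rightarrow> nat \<Rightarrow> 'a list" where
  "embed m y j = map y [j..<j+m]"

text \<open>rho(sigma^i z, sigma^j z) = 2^(-min{k. z(i+k) ~= z(j+k)}), and 0 if equal.\<close>
definition shift_dist :: "(nat \<Rightarrow> 'a) \<Rightarrow> nat \<Rightarrow> nat \<Rightarrow> real" where
  "shift_dist z i j =
     (if (\<forall>k. z (i + k) = z (j + k)) then 0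
      else 2 powr (- real (LEAST k. z (i + k) \<noteq> z (j + k))))"

text \<open>Entry (i,j) of the recurrence plot R(z,n,eps) (for 0 <= i,j < n).\<close>
definition rp :: "(nat \<Rightarrow> 'a) \<Rightarrow> real \<Rightarrow> nat \<Rightarrow> nat \<Rightarrow> bool" where
  "rp z \<epsilon> i j \<longleftrightarrow> shift_dist z i j \<le> \<epsilon>"

definition lines :: "(nat \<Rightarrow> 'a) \<Rightarrow> nat \<Rightarrow> real \<Rightarrow> nat \<Rightarrow> (nat \<times> nat) set" where
  "lines z n \<epsilon> l = {(i, j). 1 \<le> l \<and> l \<le> n \<and> i \<le> n - l \<and> j \<le> n - l \<and> i \<noteq> j \<and>
      (\<forall>k<l. rp z \<epsilon> (i + k) (j + k)) \<and>
      (min i j > 0 \<longrightarrow> \<not> rp z \<epsilon> (i - 1) (j - 1)) \<and>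
      (max i j < n - l \<longrightarrow> \<not> rp z \<epsilon> (i + l) (j + l))}"

definition N_lines :: "(nat \<Rightarrow> 'a) \<Rightarrow> nat \<Rightarrow> real \<Rightarrow> nat \<Rightarrow> nat" where
  "N_lines z n \<epsilon> l = card (lines z n \<epsilon> l)"

definition lambda_l :: "(nat \<Rightarrow> 'a) \<Rightarrow> nat \<Rightarrow> real \<Rightarrow> nat \<Rightarrow> real" where
  "lambda_l z n \<epsilon> l = real (N_lines z n \<epsilon> l) / (real n ^ 2 - real n)"

text \<open>RR_ell = sum_{l >= ell} l * lambda_l; lines have length at most n.\<close>
definition RR :: "(nat \<Rightarrow> 'a) \<Rightarrow> nat \<Rightarrow> real \<Rightarrow> nat \<Rightarrow> real" where
  "RR z n \<epsilon> L = (\<Sum>l\<in>{L..n}. real l * lambda_l z n \<epsilon> l)"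

definition DET :: "(nat \<Rightarrow> 'a) \<Rightarrow> nat \<Rightarrow> real \<Rightarrow> nat \<Rightarrow> real" where
  "DET z n \<epsilon> L = RR z n \<epsilon> L / RR z n \<epsilon> 1"

definition DET_inf :: "(nat \<Rightarrow> 'a) \<Rightarrow> real \<Rightarrow> nat \<Rightarrow> real" where
  "DET_inf z \<epsilon> L = lim (\<lambda>n. DET z n \<epsilon> L)"

end

theory Submission
  imports Defs "HOL-Analysis.Convex" "HOL-Analysis.Elementary_Normed_Spaces"
begin

text \<open>
  For small \<open>\<epsilon>\<close> two positions of \<open>y\<^sup>(\<^sup>m\<^sup>)\<close> are recurrent iff \<open>y\<close> reads the same word of some length \<open>w\<close>
  at both, where \<open>w \<rightarrow> \<infinity>\<close> as \<open>\<epsilon> \<rightarrow> 0\<close>. Let \<open>C k\<close> be the asymptotic density of the pairs of positions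
  at which \<open>y\<close> agrees on \<open>k\<close> letters. It exists because \<open>y\<close> has word frequencies: the
  frequencies of a word in the blocks \<open>\<zeta>\<^sup>k(0)\<close> and \<open>\<zeta>\<^sup>k(1)\<close> approach each other geometrically, except when
  both \<open>\<zeta>(0)\<close> and \<open>\<zeta>(1)\<close> are constant and distinct, and then \<open>y\<close> itself is constant.

  Lines of length \<open>l\<close> have density \<open>C k - 2 C (k+1) + C (k+2)\<close> with \<open>k = w + l - 1\<close>, and the off-diagonal
  recurrences, each on exactly one line, have density \<open>C w\<close>. So \<open>C\<close> is nonincreasing and convex, and
  the loss \<open>1 - DET\<close> is bounded by a multiple of \<open>(C w - C (w+1)) / C w\<close>. This quotient tends to 0: if
  \<open>lim C > 0\<close> that is clear, and if \<open>lim C = 0\<close>, then convexity gives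
  \<open>w (C w - C (w+1)) \<le> 2 C (w div 2) \<rightarrow> 0\<close>, while \<open>C w \<ge> const / w\<close> by the Cauchy-Schwarz inequality,
  because \<open>y\<close> has only \<open>O(w)\<close> words of length \<open>w\<close>.
\<close>

section \<open>Recurrence plots and pairs of agreeing positions\<close>

definition agree :: "(nat \<Rightarrow> 'a) \<Rightarrow> nat \<Rightarrow> nat \<Rightarrow> nat \<Rightarrow> bool" where
  "agree y k i j \<longleftrightarrow> (\<forall>t<k. y (i + t) = y (j + t))"

definition agree_pairs :: "(nat \<Rightarrow> 'a) \<Rightarrow> nat \<Rightarrow> nat \<Rightarrow> (nat \<times> nat) set" where
  "agree_pairs y k n = {(i, j). i < n \<and> j < n \<and> agree y k i j}"

text \<open>The agreement of length \<open>k\<close> starts at \<open>(Suc i, Suc j)\<close> and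
  extends neither to the left nor to the right. Indexing it by its left neighbour
  \<open>(i, j)\<close> avoids subtraction on natural numbers.\<close>

definition isolated_pairs :: "(nat \<Rightarrow> 'a) \<Rightarrow> nat \<Rightarrow> nat \<Rightarrow> (nat \<times> nat) set" where
  "isolated_pairs y k n = {(i, j). i < n \<and> j < n \<and> agree y k (Suc i) (Suc j) \<and>
     y i \<noteq> y j \<and> y (Suc i + k) \<noteq> y (Suc j + k)}"

text \<open>The number of letters that must agree for two shifts to be within distance
  \<open>\<epsilon>\<close>, for positive \<open>\<epsilon>\<close>.\<close>

definition window :: "real \<Rightarrow> nat" where
  "window \<epsilon> = (LEAST h. 2 powr - real h \<le> \<epsilon>)"

lemma agree_mono: "agree y k i j \<Longrightarrow> k' \<le> k \<Longrightarrow> agree y k' i j"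
  by (auto simp: agree_def)

lemma agree_Suc: "agree y (Suc k) i j \<longleftrightarrow> agree y k i j \<and> y (i + k) = y (j + k)"
  by (auto simp: agree_def less_Suc_eq)

lemma agree_Suc_left: "agree y (Suc k) i j \<longleftrightarrow> y i = y j \<and> agree y k (Suc i) (Suc j)"
  unfolding agree_def by (subst All_less_Suc2) auto

lemma agree_map_iff: "agree y k i j \<longleftrightarrow> map y [i..<i+k] = map y [j..<j+k]"
  by (auto simp: agree_def list_eq_iff_nth_eq)

lemma window_le_iff:
  assumes "0 < \<epsilon>"
  shows "2 powr - real k \<le> \<epsilon> \<longleftrightarrow> window \<epsilon> \<le> k"
proof
  assume "2 powr - real k \<le> \<epsilon>"
  then show "window \<epsilon> \<le> k" unfolding window_def by (rule Least_le)
next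
  assume le: "window \<epsilon> \<le> k"
  obtain h :: nat where "(1/2::real) ^ h < \<epsilon>"
    using real_arch_pow_inv[of \<epsilon> "1/2"] assms by auto
  then have "2 powr - real h \<le> \<epsilon>"
    by (simp add: powr_minus powr_realpow power_divide field_simps)
  then have "2 powr - real (window \<epsilon>) \<le> \<epsilon>"
    unfolding window_def by (rule LeastI)
  moreover have "(2::real) powr - real k \<le> 2 powr - real (window \<epsilon>)"
    using le by simp
  ultimately show "2 powr - real k \<le> \<epsilon>" by linarith
qed

text \<open>A positive distance is \<open>2 powr - k\<close> with \<open>k\<close> the first
  mismatch, and it is at most \<open>\<epsilon>\<close> iff no mismatch comes before
  \<open>window \<epsilon>\<close>. Without any mismatch the distance is 0.\<close>

lemma rp_iff_agree:
  assumes "0 < \<epsilon>"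
  shows "rp z \<epsilon> i j \<longleftrightarrow> agree z (window \<epsilon>) i j"
proof (cases "\<forall>k. z (i + k) = z (j + k)")
  case True
  then show ?thesis using assms by (simp add: rp_def shift_dist_def agree_def)
next
  case False
  define k where "k = (LEAST k. z (i + k) \<noteq> z (j + k))"
  have k: "z (i + k) \<noteq> z (j + k)"
    unfolding k_def using False by (metis (mono_tags, lifting) LeastI)
  have below: "z (i + t) = z (j + t)" if "t < k" for t
    using not_less_Least that unfolding k_def by blast
  have "rp z \<epsilon> i j \<longleftrightarrow> 2 powr - real k \<le> \<epsilon>"
    unfolding rp_def shift_dist_def k_def if_not_P[OF False] ..
  also have "\<dots> \<longleftrightarrow> window \<epsilon> \<le> k" by (rule window_le_iff[OF assms])
  also have "\<dots> \<longleftrightarrow> agree z (window \<epsilon>) i j"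
    using k below unfolding agree_def by (metis leI less_le_trans)
  finally show ?thesis .
qed

lemma agree_embed_iff_all: "agree (embed m y) h i j \<longleftrightarrow> (\<forall>s<h. agree y m (i + s) (j + s))"
  by (simp only: agree_def[of "embed m y"] embed_def agree_map_iff[of y])

text \<open>The \<open>h\<close> consecutive overlapping blocks of length \<open>m\<close> together
  cover \<open>h + m - 1\<close> letters. For \<open>h = 0\<close> the left side would be vacuous
  while the right side still tests \<open>m - 1\<close> letters.\<close>

lemma agree_embed:
  assumes "1 \<le> h" and "1 \<le> m"
  shows "agree (embed m y) h i j \<longleftrightarrow> agree y (h + m - 1) i j"
proof
  assume a: "agree (embed m y) h i j"
  show "agree y (h + m - 1) i j"
    unfolding agree_def
  proof (intro allI impI)
    fix t assume t: "t < h + m - 1"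
    \<comment> \<open>Letter \<open>t\<close> belongs to the block starting at \<open>s\<close>: the
      block at \<open>t\<close> itself if there is one, otherwise the last block.\<close>
    define s where "s = min t (h - 1)"
    have s: "s < h" "t - s < m" "s \<le> t" using t assms by (auto simp: s_def)
    have "agree y m (i + s) (j + s)"
      using a s(1) by (simp add: agree_embed_iff_all)
    then have "y (i + s + (t - s)) = y (j + s + (t - s))"
      using s(2) by (auto simp: agree_def)
    then show "y (i + t) = y (j + t)" using s(3) by simp
  qed
next
  assume a: "agree y (h + m - 1) i j"
  have "agree y m (i + s) (j + s)" if "s < h" for s
    unfolding agree_def
  proof (intro allI impI)
    fix t assume "t < m"
    then have "s + t < h + m - 1" using that by linarith
    then show "y (i + s + t) = y (j + s + t)"
      using a by (simp add: agree_def add.assoc)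
  qed
  then show "agree (embed m y) h i j"
    by (simp add: agree_embed_iff_all)
qed

lemma window_at_top: "filterlim window at_top (at_right 0)"
  unfolding filterlim_at_top
proof
  fix H :: nat
  have "\<forall>\<^sub>F \<epsilon> in at_right 0. \<epsilon> < 2 powr - real H"
    by (rule order_tendstoD[OF tendsto_ident_at]) simp
  then show "\<forall>\<^sub>F \<epsilon> in at_right 0. H \<le> window \<epsilon>"
    using eventually_at_right_less[of "0::real"]
  proof eventually_elim
    case (elim \<epsilon>)
    then show ?case using window_le_iff[of \<epsilon> H] by linarith
  qed
qed

section \<open>Lines partition the off-diagonal recurrences\<close>

lemma finite_lines: "finite (lines z n \<epsilon> l)"
  by (rule finite_subset[of _ "{..n} \<times> {..n}"]) (auto simp: lines_def)

lemma finite_agree_pairs: "finite (agree_pairs y k n)"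
  by (rule finite_subset[of _ "{..n} \<times> {..n}"]) (auto simp: agree_pairs_def)

text \<open>Each off-diagonal recurrence lies on exactly one line, so pairing a line with an offset
  along it gives a bijection \<open>f\<close> onto the recurrences. This turns \<open>RR\<close> at
  1 into a plain count of recurrences.\<close>

lemma sum_length_N_lines:
  "(\<Sum>l = 1..n. l * N_lines z n \<epsilon> l) = card {(a, b). a < n \<and> b < n \<and> a \<noteq> b \<and> rp z \<epsilon> a b}"
    (is "_ = card ?R")
proof -
  let ?S = "SIGMA l:{1..n}. lines z n \<epsilon> l \<times> {..<l}"
  define f :: "nat \<times> (nat \<times> nat) \<times> nat \<Rightarrow> nat \<times> nat"
    where "f = (\<lambda>(l, (i, j), k). (i + k, j + k))"
  \<comment> \<open>If two lines share a point and one starts later, the cell before its start lies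
    on the other line, against its left maximality.\<close>
  have no_earlier: "\<not> i < i'" if "(i, j) \<in> lines z n \<epsilon> l" "k < l" "(i', j') \<in> lines z n \<epsilon> l'"
      "i + k = i' + k'" "j + k = j' + k'" for l i j k l' i' j' k'
  proof
    assume "i < i'"
    then obtain d where d: "i' = i + Suc d"
      using less_imp_Suc_add by fastforce
    have j': "j' = j + Suc d" and "d < k" using that d by linarith+
    then have "rp z \<epsilon> (i + d) (j + d)" using that(1,2) by (auto simp: lines_def)
    moreover have "\<not> rp z \<epsilon> (i + d) (j + d)" using that(3) d j' by (auto simp: lines_def)
    ultimately show False by blast
  qed
  \<comment> \<open>The cell after the end of the shorter line would lie on the longer one, against
    right maximality.\<close>
  have no_longer: "\<not> l < l'" if "(i, j) \<in> lines z n \<epsilon> l" "(i, j) \<in> lines z n \<epsilon> l'" for i j l l'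
    using that by (auto simp: lines_def max_def split: if_splits)
  have inj: "inj_on f ?S"
  proof (rule inj_onI)
    fix p p' assume p: "p \<in> ?S" and p': "p' \<in> ?S" and eq: "f p = f p'"
    obtain l i j k where P: "p = (l, (i, j), k)" by (metis prod.collapse)
    obtain l' i' j' k' where P': "p' = (l', (i', j'), k')" by (metis prod.collapse)
    have m: "(i, j) \<in> lines z n \<epsilon> l" "k < l" "(i', j') \<in> lines z n \<epsilon> l'" "k' < l'"
      "i + k = i' + k'" "j + k = j' + k'"
      using p p' eq P P' by (auto simp: f_def)
    have "i = i'"
      using no_earlier[OF m(1,2,3,5,6)] no_earlier[OF m(3,4,1) m(5)[symmetric] m(6)[symmetric]]
      by linarith
    then have "k = k'" "j = j'" using m by auto
    moreover have "l = l'"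
      using no_longer m(1,3) \<open>i = i'\<close> \<open>j = j'\<close> by (metis nat_neq_iff)
    ultimately show "p = p'" using P P' \<open>i = i'\<close> by simp
  qed
  have img: "f ` ?S = ?R"
  proof
    show "f ` ?S \<subseteq> ?R" by (auto simp: f_def lines_def)
    show "?R \<subseteq> f ` ?S"
    proof
      fix p assume "p \<in> ?R"
      then obtain a b where p: "p = (a, b)" and ab: "a < n" "b < n" "a \<noteq> b" "rp z \<epsilon> a b" by auto
      \<comment> \<open>The line through \<open>(a, b)\<close> is found by walking along the
        diagonal in both directions until the border of the plot or a non-recurrence stops the walk,
        after \<open>k\<close> steps back and \<open>r\<close> steps forward. Counting
        \<open>(a, b)\<close> itself, its length is \<open>k + Suc r\<close>.\<close>
      define stopb where "stopb = (\<lambda>k. k = min a b \<or> \<not> rp z \<epsilon> (a - Suc k) (b - Suc k))"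
      define stopf where "stopf = (\<lambda>k. max a b + Suc k = n \<or> \<not> rp z \<epsilon> (a + Suc k) (b + Suc k))"
      define k where "k = (LEAST k. stopb k)"
      define r where "r = (LEAST r. stopf r)"
      have k: "stopb k" unfolding k_def by (rule LeastI[of _ "min a b"]) (simp add: stopb_def)
      have k_least: "\<not> stopb t" if "t < k" for t using that not_less_Least unfolding k_def by blast
      have r: "stopf r" unfolding r_def
        by (rule LeastI[of _ "n - Suc (max a b)"]) (use ab in \<open>simp add: stopf_def\<close>)
      have r_least: "\<not> stopf t" if "t < r" for t using that not_less_Least unfolding r_def by blast
      have k_le: "k \<le> min a b"
        unfolding k_def by (rule Least_le) (simp add: stopb_def)
      have r_le: "r \<le> n - Suc (max a b)"
        unfolding r_def by (rule Least_le) (use ab in \<open>simp add: stopf_def\<close>)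
      have r_le': "a + Suc r \<le> n" "b + Suc r \<le> n" using r_le ab by auto
      have rp_all: "rp z \<epsilon> (a - k + t) (b - k + t)" if t: "t < k + Suc r" for t
      proof -
        consider "t < k" | "t = k" | "t > k" by linarith
        then show ?thesis
        proof cases
          case 1
          then have "\<not> stopb (k - Suc t)" by (intro k_least) auto
          moreover have "a - Suc (k - Suc t) = a - k + t" "b - Suc (k - Suc t) = b - k + t"
            using 1 k_le by auto
          ultimately show ?thesis by (simp add: stopb_def)
        next
          case 2 then show ?thesis using ab k_le by simp
        next
          case 3
          then have "\<not> stopf (t - Suc k)" using t by (intro r_least) auto
          moreover have "a + Suc (t - Suc k) = a - k + t" "b + Suc (t - Suc k) = b - k + t"
            using 3 k_le by auto
          ultimately show ?thesis by (simp add: stopf_def)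
        qed
      qed
      have left: "\<not> rp z \<epsilon> (a - k - 1) (b - k - 1)" if "min (a - k) (b - k) > 0"
        using k that by (auto simp: stopb_def min_def split: if_splits)
      have "\<not> rp z \<epsilon> (a + Suc r) (b + Suc r)" if "max (a - k) (b - k) < n - (k + Suc r)"
        using r that k_le by (auto simp: stopf_def max_def split: if_splits)
      moreover have "a - k + (k + Suc r) = a + Suc r" "b - k + (k + Suc r) = b + Suc r"
        using k_le by auto
      ultimately have right: "\<not> rp z \<epsilon> (a - k + (k + Suc r)) (b - k + (k + Suc r))"
        if "max (a - k) (b - k) < n - (k + Suc r)" using that by metis
      have "a - k \<noteq> b - k" using ab k_le by auto
      then have "(a - k, b - k) \<in> lines z n \<epsilon> (k + Suc r)"
        using rp_all left right r_le' k_le unfolding lines_def by auto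
      moreover have "k + Suc r \<in> {1..n}" using r_le' k_le by auto
      ultimately have "(k + Suc r, (a - k, b - k), k) \<in> ?S" by auto
      moreover have "f (k + Suc r, (a - k, b - k), k) = p"
        using p k_le by (simp add: f_def)
      ultimately show "p \<in> f ` ?S" by (rule image_eqI[OF sym, rotated])
    qed
  qed
  have "card ?S = card ?R" using card_image[OF inj] unfolding img by simp
  moreover have "card ?S = (\<Sum>l = 1..n. card (lines z n \<epsilon> l \<times> {..<l}))"
    by (subst card_SigmaI) (auto intro: finite_lines)
  ultimately show ?thesis
    by (simp add: card_cartesian_product N_lines_def mult.commute)
qed

section \<open>Counting lines up to boundary terms\<close>

lemma card_diff_le_of_subset_Un:
  assumes "finite A" "finite B" "finite T" "A \<subseteq> B \<union> T" "B \<subseteq> A \<union> T"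
  shows "\<bar>real (card A) - real (card B)\<bar> \<le> real (card T)"
proof -
  have "card A \<le> card B + card T" "card B \<le> card A + card T"
    using assms card_mono[of "B \<union> T" A] card_mono[of "A \<union> T" B]
      card_Un_le[of B T] card_Un_le[of A T] by auto
  then show ?thesis by linarith
qed

text \<open>Exceptional pairs, linearly many in \<open>n\<close> for \<open>T\<close> of bounded
  size and hence negligible against \<open>n^2\<close>. Coordinates run up to \<open>n\<close>
  inclusive because pairs moved by \<open>Suc\<close> may reach \<open>n\<close>.\<close>

definition border :: "nat set \<Rightarrow> nat \<Rightarrow> (nat \<times> nat) set" where
  "border T n = T \<times> {..n} \<union> {..n} \<times> T"

lemma finite_border: "finite T \<Longrightarrow> finite (border T n)"
  by (simp add: border_def)

lemma card_border_le: "finite T \<Longrightarrow> card (border T n) \<le> 2 * card T * Suc n"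
  unfolding border_def using card_Un_le[of "T \<times> {..n}" "{..n} \<times> T"]
  by (simp add: card_cartesian_product mult.commute)

lemma finite_isolated_pairs: "finite (isolated_pairs y k n)"
  by (rule finite_subset[of _ "{..n} \<times> {..n}"]) (auto simp: isolated_pairs_def)

text \<open>A run of \<open>l\<close> successive agreements on \<open>w\<close> letters is one
  agreement on \<open>w + l - 1\<close> letters, and maximality of the line says that it extends in
  neither direction. Away from the border the correspondence is exact up to moving both coordinates
  by \<open>Suc\<close>.\<close>

lemma lines_near_isolated_pairs:
  assumes rp: "\<And>i j. rp z \<epsilon> i j \<longleftrightarrow> agree y w i j" and "1 \<le> w" and "1 \<le> l"
  shows "\<bar>real (N_lines z n \<epsilon> l) - real (card (isolated_pairs y (w + l - 1) n))\<bar>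
    \<le> real (2 * (l + 2)) * (real n + 1)"
proof -
  let ?K = "w + l - 1"
  \<comment> \<open>Outside these coordinates both maximality clauses of \<open>lines\<close> are in
    force: there is a cell before the start, and the cell after the end lies inside the
    plot.\<close>
  let ?T = "insert 0 {n - l..n}"
  let ?E = "map_prod Suc Suc ` isolated_pairs y ?K n"
  have run: "(\<forall>k<l. agree y w (i + k) (j + k)) \<longleftrightarrow> agree y ?K i j" for i j
  proof
    assume a: "\<forall>k<l. agree y w (i + k) (j + k)"
    show "agree y ?K i j" unfolding agree_def
    proof (intro allI impI)
      fix t assume t: "t < ?K"
      define s where "s = min t (l - 1)"
      have s: "s < l" "t - s < w" "s \<le> t" using t assms by (auto simp: s_def)
      then have "y (i + s + (t - s)) = y (j + s + (t - s))"
        using a unfolding agree_def by blast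
      then show "y (i + t) = y (j + t)" using s(3) by simp
    qed
  next
    assume a: "agree y ?K i j"
    show "\<forall>k<l. agree y w (i + k) (j + k)"
      using a by (auto simp: agree_def add.assoc)
  qed
  have Kw: "agree y ?K i j \<Longrightarrow> agree y (w - 1) i j" for i j
    by (rule agree_mono) (use assms in auto)
  \<comment> \<open>Of the \<open>w\<close> letters compared in the cell before the run, the last
    \<open>w - 1\<close> already agree, so a single letter decides. The same holds in
    \<open>right\<close> for the cell after the run.\<close>
  have left: "agree y w i j \<longleftrightarrow> y i = y j" if "agree y ?K (Suc i) (Suc j)" for i j
    using agree_Suc_left[of y "w - 1" i j] Kw[OF that] assms by auto
  have right: "agree y w (i + l) (j + l) \<longleftrightarrow> y (i + ?K) = y (j + ?K)" if "agree y ?K i j" for i j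
  proof -
    have "agree y (w - 1) (i + l) (j + l)"
      using that assms by (auto simp: agree_def add.assoc)
    then show ?thesis
      using agree_Suc[of y "w - 1" "i + l" "j + l"] assms by (auto simp: algebra_simps)
  qed
  have mem: "(Suc i, Suc j) \<in> lines z n \<epsilon> l \<longleftrightarrow> (i, j) \<in> isolated_pairs y ?K n"
    if "Suc i < n - l" "Suc j < n - l" for i j
    using that left[of i j] right[of "Suc i" "Suc j"] run[of "Suc i" "Suc j"] assms(3)
    by (auto simp: lines_def isolated_pairs_def rp)
  have "lines z n \<epsilon> l \<subseteq> ?E \<union> border ?T n"
  proof
    fix p assume p: "p \<in> lines z n \<epsilon> l"
    obtain i j where ij: "p = (i, j)" by force
    have le: "i \<le> n" "j \<le> n" using p ij by (auto simp: lines_def)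
    show "p \<in> ?E \<union> border ?T n"
    proof (cases "i \<in> ?T \<or> j \<in> ?T")
      case True
      then show ?thesis using ij le by (auto simp: border_def)
    next
      case False
      then obtain i' j' where s: "i = Suc i'" "j = Suc j'"
        by (metis insertCI not0_implies_Suc)
      have "Suc i' < n - l" "Suc j' < n - l" using False s le by auto
      from mem[OF this] p ij s show ?thesis by force
    qed
  qed
  moreover have "?E \<subseteq> lines z n \<epsilon> l \<union> border ?T n"
  proof
    fix p assume "p \<in> ?E"
    then obtain i j where ij: "p = (Suc i, Suc j)" "(i, j) \<in> isolated_pairs y ?K n" by auto
    have le: "Suc i \<le> n" "Suc j \<le> n" using ij by (auto simp: isolated_pairs_def)
    show "p \<in> lines z n \<epsilon> l \<union> border ?T n"
    proof (cases "Suc i \<in> ?T \<or> Suc j \<in> ?T")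
      case True
      then show ?thesis using ij le by (auto simp: border_def)
    next
      case False
      then have "Suc i < n - l" "Suc j < n - l" using le by auto
      from mem[OF this] ij show ?thesis by auto
    qed
  qed
  ultimately have "\<bar>real (card (lines z n \<epsilon> l)) - real (card ?E)\<bar> \<le> real (card (border ?T n))"
    by (intro card_diff_le_of_subset_Un finite_border finite_imageI finite_lines
        finite_isolated_pairs) auto
  moreover have "card (border ?T n) \<le> 2 * (l + 2) * Suc n"
  proof -
    have "card ?T \<le> l + 2"
      by (simp add: card_insert_if)
    then show ?thesis
      using card_border_le[of ?T n] by (meson finite_atLeastAtMost finite_insert le_refl mult_le_mono order_trans)
  qed
  moreover have "card ?E = card (isolated_pairs y ?K n)"
    by (rule card_image) (auto simp: inj_on_def)
  ultimately have "\<bar>real (N_lines z n \<epsilon> l) - real (card (isolated_pairs y ?K n))\<bar>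
      \<le> real (2 * (l + 2) * Suc n)"
    unfolding N_lines_def by linarith
  also have "real (2 * (l + 2) * Suc n) = real (2 * (l + 2)) * (real n + 1)"
    by (simp add: algebra_simps)
  finally show ?thesis .
qed

text \<open>Inclusion-exclusion: from the agreements of length \<open>k\<close> remove those
  extendable to the left and those extendable to the right; the ones extendable both ways are
  agreements of length \<open>k + 2\<close>. Two of the four counts start at the shifted pair
  \<open>(Suc i, Suc j)\<close>, and undoing each shift costs \<open>4 * (n + 1)\<close>.\<close>

lemma isolated_pairs_near_second_difference:
  "\<bar>real (card (isolated_pairs y k n)) -
     (real (card (agree_pairs y k n)) - 2 * real (card (agree_pairs y (Suc k) n))
      + real (card (agree_pairs y (Suc (Suc k)) n)))\<bar> \<le> 8 * (real n + 1)"
proof -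
  define S where "S = (\<lambda>k. {(i, j). i < n \<and> j < n \<and> agree y k (Suc i) (Suc j)})"
  have fin: "finite (S k)" for k
    by (rule finite_subset[of _ "{..n} \<times> {..n}"]) (auto simp: S_def)
  have shift: "\<bar>real (card (S k)) - real (card (agree_pairs y k n))\<bar> \<le> 4 * (real n + 1)" for k
  proof -
    let ?I = "map_prod Suc Suc ` S k"
    have "agree_pairs y k n \<subseteq> ?I \<union> border {0, n} n"
    proof
      fix p assume p: "p \<in> agree_pairs y k n"
      obtain i j where ij: "p = (i, j)" by force
      show "p \<in> ?I \<union> border {0, n} n"
      proof (cases "i = 0 \<or> j = 0")
        case True
        then show ?thesis using p ij by (auto simp: border_def agree_pairs_def)
      next
        case False
        then obtain i' j' where s: "i = Suc i'" "j = Suc j'"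
          by (metis not0_implies_Suc)
        have "(i', j') \<in> S k" using p ij s by (auto simp: S_def agree_pairs_def)
        then show ?thesis using ij s by force
      qed
    qed
    moreover have "?I \<subseteq> agree_pairs y k n \<union> border {0, n} n"
      by (auto simp: S_def agree_pairs_def border_def)
    ultimately have "\<bar>real (card ?I) - real (card (agree_pairs y k n))\<bar> \<le> real (card (border {0, n} n))"
      by (intro card_diff_le_of_subset_Un finite_border finite_imageI fin finite_agree_pairs) auto
    moreover have "card (border {0, n} n) \<le> 4 * Suc n"
      using card_border_le[of "{0, n}" n] by (simp add: card_insert_if split: if_splits)
    moreover have "card ?I = card (S k)"
      by (rule card_image) (auto simp: inj_on_def)
    ultimately have "\<bar>real (card (S k)) - real (card (agree_pairs y k n))\<bar> \<le> real (4 * Suc n)"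
      by linarith
    then show ?thesis by simp
  qed
  have S_Suc: "S (Suc k) = {(i, j). i < n \<and> j < n \<and> agree y k (Suc i) (Suc j) \<and>
      y (Suc i + k) = y (Suc j + k)}"
    unfolding S_def by (simp only: agree_Suc)
  have A_Suc: "agree_pairs y (Suc k) n = {(i, j). i < n \<and> j < n \<and> y i = y j \<and> agree y k (Suc i) (Suc j)}"
    unfolding agree_pairs_def by (simp only: agree_Suc_left)
  have E: "isolated_pairs y k n = S k - (agree_pairs y (Suc k) n \<union> S (Suc k))"
    unfolding S_Suc A_Suc unfolding isolated_pairs_def S_def by auto
  have "agree y (Suc (Suc k)) i j \<longleftrightarrow>
      y i = y j \<and> agree y k (Suc i) (Suc j) \<and> y (Suc i + k) = y (Suc j + k)" for i j
    by (simp only: agree_Suc_left[of y "Suc k"] agree_Suc[of y k "Suc i"])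
  then have I: "agree_pairs y (Suc k) n \<inter> S (Suc k) = agree_pairs y (Suc (Suc k)) n"
    unfolding S_Suc A_Suc by (auto simp: agree_pairs_def)
  have sub: "agree_pairs y (Suc k) n \<union> S (Suc k) \<subseteq> S k"
    unfolding S_Suc A_Suc unfolding S_def by auto
  have "card (isolated_pairs y k n) + card (agree_pairs y (Suc k) n \<union> S (Suc k)) = card (S k)"
    unfolding E using sub fin
    by (metis card_Diff_subset card_mono finite_subset le_add_diff_inverse2)
  moreover have "card (agree_pairs y (Suc k) n) + card (S (Suc k)) =
     card (agree_pairs y (Suc k) n \<union> S (Suc k)) + card (agree_pairs y (Suc (Suc k)) n)"
    using card_Un_Int[OF finite_agree_pairs fin, of y "Suc k" n "Suc k"] I by simp
  ultimately have "real (card (isolated_pairs y k n)) = real (card (S k))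
     - real (card (agree_pairs y (Suc k) n)) - real (card (S (Suc k)))
     + real (card (agree_pairs y (Suc (Suc k)) n))"
    by linarith
  then show ?thesis using shift[of k] shift[of "Suc k"] by argo
qed

section \<open>Word frequencies and complexity of substitution sequences\<close>

definition block :: "(bool \<Rightarrow> bool list) \<Rightarrow> nat \<Rightarrow> bool \<Rightarrow> bool list" where
  "block \<zeta> k a = (subst_word \<zeta> ^^ k) [a]"

lemma subst_word_funpow: "(subst_word \<zeta> ^^ k) v = concat (map (block \<zeta> k) v)"
proof (induction k arbitrary: v)
  case 0
  show ?case by (induction v) (auto simp: block_def)
next
  case (Suc k)
  have [simp]: "(subst_word \<zeta> ^^ k) [] = []"
    by (induction k) (auto simp: subst_word_def)
  have app: "(subst_word \<zeta> ^^ k) (u @ v) = (subst_word \<zeta> ^^ k) u @ (subst_word \<zeta> ^^ k) v" for u v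
    by (simp add: Suc.IH)
  have "(subst_word \<zeta> ^^ k) (concat (map \<zeta> v)) = concat (map (\<lambda>a. (subst_word \<zeta> ^^ k) (\<zeta> a)) v)"
    by (induction v) (simp_all add: app)
  then show ?case
    by (simp add: funpow_Suc_right block_def subst_word_def[of \<zeta> "[a]" for a]
        subst_word_def[of \<zeta> v] del: funpow.simps)
qed

text \<open>The hierarchy of the substitution: every block of a higher level is cut into blocks of
  level \<open>k\<close>.\<close>

lemma block_add: "block \<zeta> (j + k) a = concat (map (block \<zeta> k) (block \<zeta> j a))"
proof -
  have "block \<zeta> (j + k) a = (subst_word \<zeta> ^^ k) (block \<zeta> j a)"
    by (simp add: block_def add.commute[of j] funpow_add)
  then show ?thesis by (simp add: subst_word_funpow)
qed

lemma block_one: "block \<zeta> (Suc 0) a = \<zeta> a"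
  by (simp add: block_def subst_word_def)

lemma length_concat_const:
  assumes "\<And>x. x \<in> set ws \<Longrightarrow> length x = n"
  shows "length (concat ws) = n * length ws"
  using assms by (induction ws) auto

lemma length_block:
  assumes "uniform_binary_subst \<zeta> q"
  shows "length (block \<zeta> k a) = q ^ k"
proof (induction k arbitrary: a)
  case 0
  show ?case by (simp add: block_def)
next
  case (Suc k)
  have "length (\<zeta> a) = q" using assms by (cases a) (auto simp: uniform_binary_subst_def)
  then show ?case
    using block_add[of \<zeta> 1 k a] length_concat_const[of "map (block \<zeta> k) (\<zeta> a)" "q ^ k"] Suc.IH
    by (auto simp: block_one mult.commute)
qed

section \<open>Cutting words into blocks, and factor complexity\<close>

lemma prefix_concat_blocks:
  assumes "prefix w (concat ws)" and "\<And>x. x \<in> set ws \<Longrightarrow> length x \<le> n"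
  shows "\<exists>us t. w = concat us @ t \<and> set us \<subseteq> set ws \<and> length t \<le> n"
  using assms
proof (induction ws arbitrary: w)
  case Nil
  then show ?case by (intro exI[of _ "[]"]) auto
next
  case (Cons x ws)
  from Cons.prems(1) consider "prefix w x" | v where "w = x @ v" "prefix v (concat ws)"
    by (auto simp: prefix_append)
  then show ?case
  proof cases
    case 1
    then have "length w \<le> n" using Cons.prems(2)[of x] prefix_length_le[of w x] by simp
    then show ?thesis by (intro exI[of _ "[]"] exI[of _ w]) auto
  next
    case 2
    then obtain us t where "v = concat us @ t" "set us \<subseteq> set ws" "length t \<le> n"
      using Cons by (meson list.set_intros(2))
    then show ?thesis using 2 by (intro exI[of _ "x # us"] exI[of _ t]) auto
  qed
qed

text \<open>By induction on \<open>ws\<close>: the factor lies in the first block, lies in the rest,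
  or straddles the boundary, where the prefix version applies. A factor inside a single block is put
  into \<open>s\<close> entirely.\<close>

lemma sublist_concat_blocks:
  assumes "sublist w (concat ws)" and "\<And>x. x \<in> set ws \<Longrightarrow> length x \<le> n"
  shows "\<exists>s us t. w = s @ concat us @ t \<and> set us \<subseteq> set ws \<and> length s \<le> n \<and> length t \<le> n"
  using assms
proof (induction ws)
  case Nil
  then show ?case by (intro exI[of _ "[]"]) auto
next
  case (Cons x ws)
  have len: "length x \<le> n" by (simp add: Cons.prems(2))
  from Cons.prems(1) consider "sublist w x" | "sublist w (concat ws)"
    | w1 w2 where "w = w1 @ w2" "suffix w1 x" "prefix w2 (concat ws)"
    by (auto simp: sublist_append)
  then show ?case
  proof cases
    case 1
    then have "length w \<le> n" using len sublist_length_le[of w x] by simp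
    then show ?thesis by (intro exI[of _ w] exI[of _ "[]"]) auto
  next
    case 2
    then obtain s us t where "w = s @ concat us @ t" "set us \<subseteq> set ws" "length s \<le> n" "length t \<le> n"
      using Cons by (meson list.set_intros(2))
    then show ?thesis by (metis set_subset_Cons subset_trans)
  next
    case 3
    then obtain us t where "w2 = concat us @ t" "set us \<subseteq> set ws" "length t \<le> n"
      using prefix_concat_blocks[of w2 ws n] Cons.prems(2) by auto
    moreover have "length w1 \<le> n" using 3(2) len suffix_length_le[of w1 x] by simp
    ultimately show ?thesis using 3(1) by (metis set_subset_Cons subset_trans)
  qed
qed

text \<open>A word no longer than a block meets at most two consecutive blocks. If there is just one
  block, it is taken for both \<open>b\<close> and \<open>c\<close>.\<close>

lemma short_sublist_concat_blocks:
  assumes "sublist w (concat ws)" and "\<And>x. x \<in> set ws \<Longrightarrow> length x = n" and "length w \<le> n"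
    and "ws \<noteq> []"
  shows "\<exists>b\<in>set ws. \<exists>c\<in>set ws. sublist w (b @ c)"
  using assms
proof (induction ws)
  case (Cons x ws)
  from Cons.prems(1) consider "sublist w x" | "ws \<noteq> []" "sublist w (concat ws)"
    | w1 w2 where "w = w1 @ w2" "suffix w1 x" "prefix w2 (concat ws)" "ws \<noteq> []"
    by (cases ws) (auto simp: sublist_append)
  then show ?case
  proof cases
    case 1
    then show ?thesis by (auto simp: sublist_append)
  next
    case 2
    then show ?thesis using Cons by (meson list.set_intros(2))
  next
    case 3
    then obtain c ws' where c: "ws = c # ws'" by (cases ws) auto
    have "length w2 \<le> length c" using 3 Cons.prems c by auto
    then have "prefix w2 c"
      using 3(3) c by (auto simp: prefix_append)
    then have "sublist w (x @ c)" using 3(1,2) by (auto simp: sublist_append)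
    then show ?thesis using c by auto
  qed
qed simp

lemma prefix_in_block:
  assumes "y \<in> subst_shift_space \<zeta>"
  obtains a K where "sublist (map y [0..<n]) (block \<zeta> K a)"
  using assms unfolding subst_shift_space_def subst_lang_def block_def by blast

lemma prefix_desubstitution:
  assumes u: "uniform_binary_subst \<zeta> q" and y: "y \<in> subst_shift_space \<zeta>"
  shows "\<exists>s v t. map y [0..<n] = s @ concat (map (block \<zeta> k) v) @ t \<and>
    length s \<le> q ^ k \<and> length t \<le> q ^ k"
proof -
  obtain a K where K: "sublist (map y [0..<n]) (block \<zeta> K a)"
    using prefix_in_block[OF y] .
  show ?thesis
  proof (cases "k \<le> K")
    case True
    then have "sublist (map y [0..<n]) (concat (map (block \<zeta> k) (block \<zeta> (K - k) a)))"
      using K block_add[of \<zeta> "K - k" k a] by simp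
    moreover have "length x \<le> q ^ k" if "x \<in> set (map (block \<zeta> k) v)" for x v
      using that by (auto simp: length_block[OF u])
    ultimately obtain s us t where *: "map y [0..<n] = s @ concat us @ t" "length s \<le> q ^ k" "length t \<le> q ^ k"
      "set us \<subseteq> set (map (block \<zeta> k) (block \<zeta> (K - k) a))"
      using sublist_concat_blocks[of "map y [0..<n]" _ "q ^ k"] by meson
    \<comment> \<open>All pieces in \<open>us\<close> are blocks of level \<open>k\<close>, so
      \<open>us\<close> is the image of some word \<open>v\<close> of letters.\<close>
    then have "us \<in> lists (range (block \<zeta> k))" by auto
    then obtain v where "us = map (block \<zeta> k) v" by (auto simp: lists_image)
    with * show ?thesis by auto
  \<comment> \<open>If the surrounding block has level below \<open>k\<close>, the whole prefix is
    short enough to serve as the remainder \<open>s\<close>.\<close>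
  next
    case False
    have "n \<le> q ^ K" using sublist_length_le[OF K] by (simp add: length_block[OF u])
    also have "\<dots> \<le> q ^ k"
      using False u by (intro power_increasing) (auto simp: uniform_binary_subst_def)
    finally show ?thesis
      by (intro exI[of _ "map y [0..<n]"] exI[of _ "[]"]) auto
  qed
qed

text \<open>A factor of length at most \<open>q ^ k\<close> sits inside two adjoining blocks of
  level \<open>k\<close>, so it is determined by two letters and an offset. That leaves
  \<open>4 * (2 * q ^ k + 1)\<close> possibilities.\<close>

lemma card_factors_le:
  assumes u: "uniform_binary_subst \<zeta> q" and y: "y \<in> subst_shift_space \<zeta>" and w: "w \<le> q ^ k"
  shows "finite (range (\<lambda>i. map y [i..<i+w]))" "card (range (\<lambda>i. map y [i..<i+w])) \<le> 12 * q ^ k"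
proof -
  let ?f = "\<lambda>(i, b, c). take w (drop i (block \<zeta> k b @ block \<zeta> k c))"
  let ?D = "{..2 * q ^ k} \<times> (UNIV :: bool set) \<times> (UNIV :: bool set)"
  have q: "2 \<le> q" using u by (simp add: uniform_binary_subst_def)
  have sub: "range (\<lambda>i. map y [i..<i+w]) \<subseteq> ?f ` ?D"
  proof safe
    fix i
    \<comment> \<open>The extra \<open>q ^ k\<close> letters force the surrounding block to have
      level \<open>K\<close> at least \<open>k\<close>.\<close>
    define n where "n = i + w + q ^ k"
    obtain a K where K: "sublist (map y [0..<n]) (block \<zeta> K a)"
      using prefix_in_block[OF y] .
    have "q ^ k \<le> q ^ K"
      using sublist_length_le[OF K] by (simp add: length_block[OF u] n_def)
    then have "k \<le> K" using q by (simp add: power_increasing_iff)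
    then have "sublist (map y [0..<n]) (concat (map (block \<zeta> k) (block \<zeta> (K - k) a)))"
      using K block_add[of \<zeta> "K - k" k a] by simp
    moreover have "map y [0..<n] = map y [0..<i] @ map y [i..<i+w] @ map y [i+w..<n]"
      using upt_add_eq_append[of 0 i "w + q ^ k"] upt_add_eq_append[of i "i + w" "q ^ k"]
      by (simp add: n_def add.assoc)
    then have "sublist (map y [i..<i+w]) (map y [0..<n])" by simp
    ultimately have "sublist (map y [i..<i+w]) (concat (map (block \<zeta> k) (block \<zeta> (K - k) a)))"
      by (meson sublist_order.order_trans)
    moreover have "block \<zeta> (K - k) a \<noteq> []"
      using length_block[OF u, of "K - k" a] q by auto
    ultimately obtain b c where "sublist (map y [i..<i+w]) (block \<zeta> k b @ block \<zeta> k c)"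
      using short_sublist_concat_blocks[of "map y [i..<i+w]" "map (block \<zeta> k) (block \<zeta> (K - k) a)"
          "q ^ k"] w length_block[OF u]
      by auto
    then obtain ps ss where ps: "block \<zeta> k b @ block \<zeta> k c = ps @ map y [i..<i+w] @ ss"
      by (auto simp: sublist_def)
    then have "(length ps, b, c) \<in> ?D"
      using arg_cong[OF ps, of length] unfolding length_append length_block[OF u] by simp
    moreover have "map y [i..<i+w] = ?f (length ps, b, c)" unfolding prod.case ps by simp
    ultimately show "map y [i..<i+w] \<in> ?f ` ?D" by (rule image_eqI[rotated])
  qed
  have fin: "finite ?D" by simp
  show "finite (range (\<lambda>i. map y [i..<i+w]))"
    using finite_subset[OF sub finite_imageI[OF fin]] .
  have "card (range (\<lambda>i. map y [i..<i+w])) \<le> card ?D"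
    using surj_card_le[OF fin sub] .
  also have "\<dots> = (2 * q ^ k + 1) * 4" by (simp add: card_cartesian_product del: UNIV_Times_UNIV)
  also have "\<dots> \<le> 12 * q ^ k" using q by (simp add: Suc_le_eq)
  finally show "card (range (\<lambda>i. map y [i..<i+w])) \<le> 12 * q ^ k" .
qed

section \<open>Existence of word frequencies\<close>

text \<open>Up to a geometrically small error, both new values are convex combinations of the two
  old ones, with weights \<open>t a / q\<close>. So the gap \<open>D\<close> shrinks by the factor
  \<open>r < 1\<close> in each step, which makes it summable; as the increments are controlled by
  the gap, both sequences converge, to a common limit.\<close>

lemma contraction_limit:
  fixes f :: "nat \<Rightarrow> bool \<Rightarrow> real" and t :: "bool \<Rightarrow> real" and q c :: real
  assumes q: "2 \<le> q" and c: "0 \<le> c" and t: "\<And>a. 0 \<le> t a" "\<And>a. t a \<le> q"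
    and gap: "\<bar>t True - t False\<bar> < q"
    and rec: "\<And>k a. \<bar>f (Suc k) a - ((q - t a) * f k False + t a * f k True) / q\<bar> \<le> c / q ^ k"
  shows "\<exists>p. \<forall>a. (\<lambda>k. f k a) \<longlonglongrightarrow> p"
proof -
  define r where "r = \<bar>t True - t False\<bar> / q"
  define D where "D k = \<bar>f k True - f k False\<bar>" for k
  have r: "0 \<le> r" "r < 1" using gap q by (auto simp: r_def)
  have D_step: "D (Suc k) \<le> r * D k + 2 * c / q ^ k" for k
  proof -
    define m where "m a = ((q - t a) * f k False + t a * f k True) / q" for a
    have "m True - m False = (t True - t False) / q * (f k True - f k False)"
      using q by (simp add: m_def field_simps)
    then have "\<bar>m True - m False\<bar> = r * D k"
      using q by (simp add: r_def D_def abs_mult)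
    moreover have "\<bar>f (Suc k) a - m a\<bar> \<le> c / q ^ k" for a
      using rec[of k a] by (simp add: m_def)
    from this[of True] this[of False]
    have "D (Suc k) \<le> \<bar>m True - m False\<bar> + (c / q ^ k + c / q ^ k)"
      unfolding D_def by linarith
    ultimately show ?thesis by simp
  qed
  have geo: "summable (\<lambda>k. c / q ^ k)"
    using summable_mult[OF summable_geometric[of "1 / q"], of c] q by (simp add: power_divide)
  \<comment> \<open>Summing \<open>D_step\<close> bounds a partial sum by \<open>r\<close> times
    itself plus a constant; since \<open>r < 1\<close> it can be solved for the sum.\<close>
  have "summable D"
  proof (rule bounded_imp_summable)
    fix n
    have "(\<Sum>k\<le>n. D k) \<le> D 0 + (\<Sum>k<n. r * D k + 2 * c / q ^ k)"
    proof (induction n)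
      case (Suc n)
      then show ?case using D_step[of n] by (simp add: lessThan_Suc_atMost[symmetric] algebra_simps)
    qed simp
    also have "(\<Sum>k<n. r * D k + 2 * c / q ^ k) = r * (\<Sum>k<n. D k) + 2 * (\<Sum>k<n. c / q ^ k)"
      by (simp add: sum.distrib sum_distrib_left)
    also have "r * (\<Sum>k<n. D k) \<le> r * (\<Sum>k\<le>n. D k)"
      using r by (intro mult_left_mono sum_mono2) (auto simp: D_def)
    also have "(\<Sum>k<n. c / q ^ k) \<le> (\<Sum>k. c / q ^ k)"
      using c q by (intro sum_le_suminf geo) auto
    finally have "(\<Sum>k\<le>n. D k) * (1 - r) \<le> D 0 + 2 * (\<Sum>k. c / q ^ k)"
      by (simp add: algebra_simps)
    then show "(\<Sum>k\<le>n. D k) \<le> (D 0 + 2 * (\<Sum>k. c / q ^ k)) / (1 - r)"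
      using r by (simp add: pos_le_divide_eq)
  qed (simp add: D_def)
  \<comment> \<open>The combination \<open>m\<close> lies between \<open>f k False\<close> and
    \<open>f k True\<close>, hence within \<open>D k\<close> of either.\<close>
  have close: "\<bar>f (Suc k) a - f k a\<bar> \<le> D k + c / q ^ k" for k a
  proof -
    define m where "m = ((q - t a) * f k False + t a * f k True) / q"
    have "m - f k False = t a / q * (f k True - f k False)"
      "f k True - m = (q - t a) / q * (f k True - f k False)"
      using q by (simp_all add: m_def field_simps)
    then have "\<bar>m - f k False\<bar> = t a / q * D k" "\<bar>m - f k True\<bar> = (q - t a) / q * D k"
      using q t[of a] by (simp_all add: D_def abs_mult abs_minus_commute[of m])
    moreover have "0 \<le> D k" "t a / q \<le> 1" "0 \<le> t a / q" "(q - t a) / q \<le> 1" "0 \<le> (q - t a) / q"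
      using q t[of a] by (simp_all add: D_def)
    then have "t a / q * D k \<le> D k" "(q - t a) / q * D k \<le> D k"
      by (simp_all only: mult_left_le_one_le)
    ultimately have "\<bar>m - f k a\<bar> \<le> D k"
      by (cases a) auto
    then show ?thesis using rec[of k a] unfolding m_def[symmetric] by linarith
  qed
  have "convergent (\<lambda>k. f k a)" for a
  proof -
    have "summable (\<lambda>k. f (Suc k) a - f k a)"
      by (rule summable_comparison_test'[OF summable_add[OF \<open>summable D\<close> geo]])
        (use close in auto)
    then obtain l where "(\<lambda>n. \<Sum>k<n. f (Suc k) a - f k a) \<longlonglongrightarrow> l"
      by (auto simp: summable_iff_convergent convergent_def)
    then have "(\<lambda>n. f n a - f 0 a + f 0 a) \<longlonglongrightarrow> l + f 0 a"
      by (intro tendsto_add tendsto_const) (simp add: sum_lessThan_telescope[of "\<lambda>k. f k a"])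
    then show ?thesis by (auto simp: convergent_def)
  qed
  then obtain p where p: "\<And>a. (\<lambda>k. f k a) \<longlonglongrightarrow> p a"
    unfolding convergent_def by metis
  have "D \<longlonglongrightarrow> 0" using \<open>summable D\<close> by (rule summable_LIMSEQ_zero)
  then have "(\<lambda>k. f k True - f k False) \<longlonglongrightarrow> 0"
    unfolding D_def by (rule tendsto_rabs_zero_cancel)
  then have "p True - p False = 0"
    using tendsto_diff[OF p p] LIMSEQ_unique by blast
  then have "p a = p True" for a by (cases a) auto
  then show ?thesis using p by metis
qed

text \<open>Starting positions stay below \<open>length v\<close> so that the count is at most
  \<open>length v\<close> even for the empty word. Near the end \<open>take\<close> returns a
  shorter list, which cannot equal \<open>u\<close>.\<close>

definition word_count :: "'a list \<Rightarrow> 'a list \<Rightarrow> nat" where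
  "word_count u v = card {i. i < length v \<and> take (length u) (drop i v) = u}"

lemma card_diff_le_interval:
  assumes "\<And>i. i < n \<Longrightarrow> i + k \<le> n \<Longrightarrow> P i \<longleftrightarrow> Q i"
  shows "\<bar>real (card {i. i < n \<and> P i}) - real (card {i. i < n \<and> Q i})\<bar> \<le> real k"
proof -
  have "card {i. i < n \<and> P i} \<le> card {i. i < n \<and> Q i} + k"
    if "\<And>i. i < n \<Longrightarrow> i + k \<le> n \<Longrightarrow> P i \<longleftrightarrow> Q i" for P Q
  proof -
    have "{i. i < n \<and> P i} \<subseteq> {i. i < n \<and> Q i} \<union> {n - k..<n}"
      using that by (auto simp: not_less)
    then have "card {i. i < n \<and> P i} \<le> card ({i. i < n \<and> Q i} \<union> {n - k..<n})"
      by (intro card_mono) auto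
    also have "\<dots> \<le> card {i. i < n \<and> Q i} + card {n - k..<n}" by (rule card_Un_le)
    finally show ?thesis by simp
  qed
  from this[of P Q] this[of Q P] have "card {i. i < n \<and> P i} \<le> card {i. i < n \<and> Q i} + k"
    "card {i. i < n \<and> Q i} \<le> card {i. i < n \<and> P i} + k" using assms by simp_all
  then show ?thesis by linarith
qed

text \<open>Appending \<open>w\<close> affects only those occurrences that start in the last
  \<open>length u\<close> positions of \<open>v\<close>.\<close>

lemma word_count_append:
  "\<bar>real (word_count u (v @ w)) - real (word_count u v) - real (word_count u w)\<bar> \<le> real (length u)"
proof -
  let ?A = "{i. i < length v \<and> take (length u) (drop i (v @ w)) = u}"
  let ?B = "{i. i < length w \<and> take (length u) (drop i w) = u}"
  have "{i. i < length (v @ w) \<and> take (length u) (drop i (v @ w)) = u} = ?A \<union> (+) (length v) ` ?B"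
  proof (intro set_eqI)
    fix i
    show "i \<in> {i. i < length (v @ w) \<and> take (length u) (drop i (v @ w)) = u} \<longleftrightarrow>
      i \<in> ?A \<union> (+) (length v) ` ?B"
    proof (cases "i < length v")
      case True
      then show ?thesis by auto
    next
      case False
      then obtain d where "i = length v + d" using le_Suc_ex not_less by blast
      then show ?thesis by auto
    qed
  qed
  moreover have "card (?A \<union> (+) (length v) ` ?B) = card ?A + card ((+) (length v) ` ?B)"
    by (intro card_Un_disjoint) auto
  ultimately have "word_count u (v @ w) = card ?A + word_count u w"
    by (simp add: word_count_def card_image)
  moreover have "\<bar>real (card ?A) - real (word_count u v)\<bar> \<le> real (length u)"
    unfolding word_count_def by (rule card_diff_le_interval) simp
  ultimately show ?thesis by simp
qed

lemma word_count_le: "word_count u v \<le> length v"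
  unfolding word_count_def by (rule order_trans[OF card_mono[of "{..<length v}"]]) auto

lemma word_count_concat:
  "\<bar>real (word_count u (concat ws)) - (\<Sum>w\<leftarrow>ws. real (word_count u w))\<bar> \<le> real (length u) * real (length ws)"
proof (induction ws)
  case Nil
  show ?case by (simp add: word_count_def)
next
  case (Cons w ws)
  then show ?case using word_count_append[of u w "concat ws"] by (simp add: algebra_simps)
qed

lemma sum_list_bool:
  fixes f :: "bool \<Rightarrow> real"
  shows "(\<Sum>a\<leftarrow>v. f a) = (real (length v) - real (count_list v True)) * f False + real (count_list v True) * f True"
  by (induction v) (auto simp: algebra_simps)

text \<open>A block of level \<open>k + 1\<close> consists of \<open>q\<close> blocks of level
  \<open>k\<close>, of which \<open>t a\<close> come from the letter \<open>True\<close>. The joints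
  cost at most \<open>length w * q\<close> occurrences, which after division by
  \<open>q ^ (k + 1)\<close> is the error allowed by \<open>contraction_limit\<close>.\<close>

lemma block_frequency:
  assumes u: "uniform_binary_subst \<zeta> q"
    and gap: "\<bar>real (count_list (\<zeta> True) True) - real (count_list (\<zeta> False) True)\<bar> < real q"
  shows "\<exists>p. \<forall>a. (\<lambda>k. real (word_count w (block \<zeta> k a)) / real q ^ k) \<longlonglongrightarrow> p"
proof -
  let ?f = "\<lambda>k a. real (word_count w (block \<zeta> k a)) / real q ^ k"
  let ?t = "\<lambda>a. real (count_list (\<zeta> a) True)"
  have q: "2 \<le> real q" using u by (simp add: uniform_binary_subst_def)
  have len: "length (\<zeta> a) = q" for a using length_block[OF u, of 1 a] by (simp add: block_one)
  show ?thesis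
  proof (rule contraction_limit[of "real q" "real (length w)" ?t ?f])
    show "?t a \<le> real q" for a using count_le_length[of "\<zeta> a" True] len[of a] by simp
    fix k a
    have "block \<zeta> (Suc k) a = concat (map (block \<zeta> k) (\<zeta> a))"
      using block_add[of \<zeta> "Suc 0" k a] by (simp add: block_one)
    then have "\<bar>real (word_count w (block \<zeta> (Suc k) a)) - (\<Sum>b\<leftarrow>\<zeta> a. real (word_count w (block \<zeta> k b)))\<bar>
        \<le> real (length w) * real q"
      using word_count_concat[of w "map (block \<zeta> k) (\<zeta> a)"] by (simp add: len comp_def)
    moreover have "(\<Sum>b\<leftarrow>\<zeta> a. real (word_count w (block \<zeta> k b))) =
        real q ^ k * ((real q - ?t a) * ?f k False + ?t a * ?f k True)"
      using q by (simp add: sum_list_bool len field_simps)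
    ultimately have "\<bar>real (word_count w (block \<zeta> (Suc k) a)) -
        real q ^ k * ((real q - ?t a) * ?f k False + ?t a * ?f k True)\<bar> / real q ^ Suc k
        \<le> real (length w) * real q / real q ^ Suc k"
      by (intro divide_right_mono) auto
    also have "real (length w) * real q / real q ^ Suc k = real (length w) / real q ^ k"
      using q by simp
    also have "\<bar>real (word_count w (block \<zeta> (Suc k) a)) -
        real q ^ k * ((real q - ?t a) * ?f k False + ?t a * ?f k True)\<bar> / real q ^ Suc k =
        \<bar>(real (word_count w (block \<zeta> (Suc k) a)) -
        real q ^ k * ((real q - ?t a) * ?f k False + ?t a * ?f k True)) / real q ^ Suc k\<bar>"
      using q by simp
    also have "(real (word_count w (block \<zeta> (Suc k) a)) -
        real q ^ k * ((real q - ?t a) * ?f k False + ?t a * ?f k True)) / real q ^ Suc k =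
        ?f (Suc k) a - ((real q - ?t a) * ?f k False + ?t a * ?f k True) / real q"
      using q by (simp add: diff_divide_distrib)
    finally show "\<bar>?f (Suc k) a - ((real q - ?t a) * ?f k False + ?t a * ?f k True) / real q\<bar>
        \<le> real (length w) / real q ^ k" .
  qed (use q gap in auto)
qed

text \<open>The order of choices matters: first \<open>k\<close> is fixed so that \<open>d k\<close>
  is small, then \<open>n\<close> is taken so large that \<open>B k / n\<close> is small.\<close>

lemma linear_rate_limit:
  fixes x :: "nat \<Rightarrow> real"
  assumes "\<And>k n. \<bar>x n - real n * p\<bar> \<le> B k + real n * d k" and "d \<longlonglongrightarrow> 0"
  shows "(\<lambda>n. x n / real n) \<longlonglongrightarrow> p"
proof (rule LIMSEQ_I)
  fix e :: real assume e: "0 < e"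
  obtain k where k: "d k < e / 2"
    using order_tendstoD(2)[OF assms(2), of "e / 2"] e by (auto simp: eventually_sequentially)
  have "(\<lambda>n. B k / real n) \<longlonglongrightarrow> 0" by (rule lim_const_over_n)
  then have "\<forall>\<^sub>F n in sequentially. B k / real n < e / 2"
    using e by (intro order_tendstoD) auto
  then have "\<forall>\<^sub>F n in sequentially. norm (x n / real n - p) < e"
    using eventually_gt_at_top[of 0]
  proof eventually_elim
    case (elim n)
    have "\<bar>x n / real n - p\<bar> = \<bar>x n - real n * p\<bar> / real n"
      using elim by (simp add: field_simps)
    also have "\<dots> \<le> (B k + real n * d k) / real n"
      using assms(1) by (intro divide_right_mono) auto
    also have "\<dots> = B k / real n + d k" using elim by (simp add: field_simps)
    also have "\<dots> < e" using elim k by linarith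
    finally show ?case by simp
  qed
  then show "\<exists>no. \<forall>n\<ge>no. norm (x n / real n - p) < e" by (simp add: eventually_sequentially)
qed

lemma word_count_prefix:
  "\<bar>real (card {i. i < n \<and> map y [i..<i + length u] = u}) - real (word_count u (map y [0..<n]))\<bar>
     \<le> real (length u)"
proof -
  have "take (length u) (drop i (map y [0..<n])) = map y [i..<i + length u]" if "i + length u \<le> n" for i
    using that by (simp add: take_map drop_map)
  then show ?thesis
    using card_diff_le_interval[of n "length u" "\<lambda>i. map y [i..<i + length u] = u"
        "\<lambda>i. take (length u) (drop i (map y [0..<n])) = u"]
    by (simp add: word_count_def)
qed

text \<open>A long prefix of \<open>y\<close> is a product of blocks of level \<open>k\<close> with
  two short remainders, and in every block the word has nearly the same frequency
  \<open>p\<close>.\<close>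

lemma word_frequency_contracting:
  assumes u: "uniform_binary_subst \<zeta> q" and y: "y \<in> subst_shift_space \<zeta>"
    and gap: "\<bar>real (count_list (\<zeta> True) True) - real (count_list (\<zeta> False) True)\<bar> < real q"
  shows "\<exists>p. (\<lambda>n. real (card {i. i < n \<and> map y [i..<i + length w] = w}) / real n) \<longlonglongrightarrow> p"
proof -
  define c where "c = real (length w)"
  define f where "f k a = real (word_count w (block \<zeta> k a)) / real q ^ k" for k a
  obtain p where p: "\<And>a. (\<lambda>k. f k a) \<longlonglongrightarrow> p"
    using block_frequency[OF u gap, of w] unfolding f_def by blast
  define \<delta> where "\<delta> k = \<bar>f k True - p\<bar> + \<bar>f k False - p\<bar>" for k
  have q: "2 \<le> real q" using u by (simp add: uniform_binary_subst_def)
  let ?x = "\<lambda>n. real (card {i. i < n \<and> map y [i..<i + length w] = w})"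
  \<comment> \<open>With \<open>Q = q ^ k\<close>: \<open>3 * c\<close> pays for the end of the
    prefix and for the joints with \<open>s\<close> and \<open>t\<close>; \<open>2 * Q\<close> and
    \<open>2 * Q * \<bar>p\<bar>\<close> pay for the letters of \<open>s\<close> and
    \<open>t\<close>; \<open>n * c / Q\<close> pays for the joints between blocks, and
    \<open>n * \<delta> k\<close> for the deviation inside the blocks.\<close>
  have bound: "\<bar>?x n - real n * p\<bar> \<le> (3 * c + 2 * real q ^ k + 2 * real q ^ k * \<bar>p\<bar>) + real n * (c / real q ^ k + \<delta> k)"
    for k n
  proof -
    define Q where "Q = real q ^ k"
    have Q: "0 < Q" using q by (simp add: Q_def)
    obtain s v t where eq: "map y [0..<n] = s @ concat (map (block \<zeta> k) v) @ t"
      and len: "length s \<le> q ^ k" "length t \<le> q ^ k"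
      using prefix_desubstitution[OF u y] by blast
    let ?V = "concat (map (block \<zeta> k) v)"
    let ?r = "real (length v)"
    have lenV: "length ?V = q ^ k * length v"
      by (subst length_concat_const[of _ "q ^ k"]) (auto simp: length_block[OF u])
    have "n = length s + length ?V + length t" using arg_cong[OF eq, of length] by simp
    then have n: "real n = real (length s) + real (length t) + Q * ?r"
      unfolding lenV by (simp add: Q_def)
    have len': "real (length s) \<le> Q" "real (length t) \<le> Q"
      using len unfolding Q_def by (metis of_nat_le_iff of_nat_power)+
    have sum_close: "\<bar>(\<Sum>a\<leftarrow>v. real (word_count w (block \<zeta> k a))) - Q * real (length v) * p\<bar> \<le> Q * real (length v) * \<delta> k" for v
    proof -
      have 1: "\<bar>real (word_count w (block \<zeta> k a)) - Q * p\<bar> \<le> Q * \<delta> k" for a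
      proof -
        have "real (word_count w (block \<zeta> k a)) - Q * p = Q * (f k a - p)"
          using Q by (simp add: f_def Q_def[symmetric] field_simps)
        moreover have "\<bar>f k a - p\<bar> \<le> \<delta> k" by (cases a) (auto simp: \<delta>_def)
        ultimately show ?thesis using Q by (simp add: abs_mult)
      qed
      show "\<bar>(\<Sum>a\<leftarrow>v. real (word_count w (block \<zeta> k a))) - Q * real (length v) * p\<bar> \<le> Q * real (length v) * \<delta> k"
      proof (induction v)
        case (Cons a v)
        then show ?case using 1[of a] by (simp add: algebra_simps)
      qed simp
    qed
    have "\<bar>real (word_count w ?V) - (\<Sum>a\<leftarrow>v. real (word_count w (block \<zeta> k a)))\<bar> \<le> c * ?r"
      using word_count_concat[of w "map (block \<zeta> k) v"] by (simp add: comp_def c_def)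
    moreover have "\<bar>real (word_count w (s @ ?V @ t)) - real (word_count w s) - real (word_count w (?V @ t))\<bar> \<le> c"
      "\<bar>real (word_count w (?V @ t)) - real (word_count w ?V) - real (word_count w t)\<bar> \<le> c"
      unfolding c_def by (rule word_count_append)+
    moreover have "\<bar>?x n - real (word_count w (s @ ?V @ t))\<bar> \<le> c"
      using word_count_prefix[of n y w] unfolding c_def eq .
    moreover have "real (word_count w s) \<le> Q" "real (word_count w t) \<le> Q"
      using word_count_le[of w s] word_count_le[of w t] len' by linarith+
    moreover have "\<bar>Q * ?r * p - real n * p\<bar> \<le> 2 * Q * \<bar>p\<bar>"
    proof -
      have "Q * ?r * p - real n * p = - ((real (length s) + real (length t)) * p)"
        unfolding n by (simp add: algebra_simps)
      then have "\<bar>Q * ?r * p - real n * p\<bar> = (real (length s) + real (length t)) * \<bar>p\<bar>"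
        by (simp add: abs_mult)
      also have "\<dots> \<le> (2 * Q) * \<bar>p\<bar>" using len' by (intro mult_right_mono) auto
      finally show ?thesis .
    qed
    ultimately have "\<bar>?x n - real n * p\<bar> \<le> 3 * c + 2 * Q + c * ?r + Q * ?r * \<delta> k + 2 * Q * \<bar>p\<bar>"
      using sum_close[of v] by linarith
    moreover have "Q * ?r \<le> real n" unfolding n by simp
    then have "Q * ?r * (c / Q + \<delta> k) \<le> real n * (c / Q + \<delta> k)"
      using Q by (intro mult_right_mono) (auto simp: c_def \<delta>_def)
    moreover have "Q * ?r * (c / Q + \<delta> k) = c * ?r + Q * ?r * \<delta> k"
      using Q by (simp add: field_simps)
    ultimately show ?thesis unfolding Q_def[symmetric] by linarith
  qed
  have "(\<lambda>k. c * (1 / real q) ^ k) \<longlonglongrightarrow> c * 0"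
    using q by (intro tendsto_mult tendsto_const LIMSEQ_realpow_zero) auto
  moreover have "\<delta> \<longlonglongrightarrow> \<bar>p - p\<bar> + \<bar>p - p\<bar>"
    unfolding \<delta>_def by (intro tendsto_intros p)
  ultimately have "(\<lambda>k. c * (1 / real q) ^ k + \<delta> k) \<longlonglongrightarrow> c * 0 + (\<bar>p - p\<bar> + \<bar>p - p\<bar>)"
    by (rule tendsto_add)
  then have "(\<lambda>k. c / real q ^ k + \<delta> k) \<longlonglongrightarrow> 0" by (simp add: power_divide)
  from linear_rate_limit[OF bound this] show ?thesis by blast
qed

text \<open>Both counts lie between 0 and \<open>q\<close>, so a difference of at least
  \<open>q\<close> makes one of them 0 and the other \<open>q\<close>. Then the image of each letter
  repeats a single letter, hence so does every block, and any prefix of \<open>y\<close> lies in a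
  block.\<close>

lemma constant_of_non_contracting:
  assumes u: "uniform_binary_subst \<zeta> q" and y: "y \<in> subst_shift_space \<zeta>"
    and gap: "\<not> \<bar>real (count_list (\<zeta> True) True) - real (count_list (\<zeta> False) True)\<bar> < real q"
  shows "y i = y 0"
proof -
  let ?t = "\<lambda>a. count_list (\<zeta> a) True"
  have len: "length (\<zeta> a) = q" for a using u by (cases a) (auto simp: uniform_binary_subst_def)
  have le: "?t a \<le> q" for a using count_le_length[of "\<zeta> a" True] len[of a] by simp
  have "real (?t False) + real q \<le> real (?t True) \<or> real (?t True) + real q \<le> real (?t False)"
    using gap by linarith
  then have "?t False + q \<le> ?t True \<or> ?t True + q \<le> ?t False" by linarith
  then have ext: "?t a = 0 \<or> ?t a = q" for a
    using le[of True] le[of False] by (cases a) auto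
  have "\<exists>b. set (\<zeta> a) \<subseteq> {b}" for a
  proof (cases "?t a = 0")
    case True
    then have "set (\<zeta> a) \<subseteq> {False}" by (auto simp: count_list_0_iff)
    then show ?thesis by blast
  next
    case False
    then have "count_list (\<zeta> a) True = length (\<zeta> a)" using ext[of a] len by simp
    moreover have "set v \<subseteq> {True}" if "count_list v True = length v" for v
      using that
    proof (induction v)
      case (Cons x v)
      then show ?case using count_le_length[of v True] by (auto split: if_splits)
    qed simp
    ultimately show ?thesis by blast
  qed
  then obtain h where h: "\<And>a. set (\<zeta> a) \<subseteq> {h a}" by metis
  have const: "\<exists>b. set (block \<zeta> k a) \<subseteq> {b}" for k a
  proof (induction k arbitrary: a)
    case 0
    show ?case by (auto simp: block_def)
  next
    case (Suc k)
    obtain b where "set (block \<zeta> k (h a)) \<subseteq> {b}" using Suc.IH by blast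
    moreover have "block \<zeta> (Suc k) a = concat (map (block \<zeta> k) (\<zeta> a))"
      using block_add[of \<zeta> "Suc 0" k a] by (simp add: block_one)
    ultimately have "set (block \<zeta> (Suc k) a) \<subseteq> {b}" using h[of a] by fastforce
    then show ?case by blast
  qed
  obtain a K where "sublist (map y [0..<Suc i]) (block \<zeta> K a)" using prefix_in_block[OF y] .
  then have "set (map y [0..<Suc i]) \<subseteq> set (block \<zeta> K a)" by (rule set_mono_sublist)
  moreover obtain b where "set (block \<zeta> K a) \<subseteq> {b}" using const by blast
  moreover have "y i \<in> set (map y [0..<Suc i])" "y 0 \<in> set (map y [0..<Suc i])"
    by (auto simp del: upt_Suc)
  ultimately show ?thesis by blast
qed

lemma word_frequency_exists:
  assumes u: "uniform_binary_subst \<zeta> q" and y: "y \<in> subst_shift_space \<zeta>"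
  shows "\<exists>p. (\<lambda>n. real (card {i. i < n \<and> map y [i..<i + length w] = w}) / real n) \<longlonglongrightarrow> p"
proof (cases "\<bar>real (count_list (\<zeta> True) True) - real (count_list (\<zeta> False) True)\<bar> < real q")
  case True
  then show ?thesis by (rule word_frequency_contracting[OF u y])
next
  case False
  then have const: "y i = y 0" for i by (rule constant_of_non_contracting[OF u y])
  have eq: "map y [i..<i + length w] = map y [0..<length w]" for i
  proof (rule nth_equalityI)
    fix j assume "j < length (map y [i..<i + length w])"
    then show "map y [i..<i + length w] ! j = map y [0..<length w] ! j"
      using const[of "i + j"] const[of j] by simp
  qed simp
  show ?thesis
  proof (cases "map y [0..<length w] = w")
    case True
    then have "{i. i < n \<and> map y [i..<i + length w] = w} = {..<n}" for n
      using eq by auto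
    then have "(\<lambda>n. real (card {i. i < n \<and> map y [i..<i + length w] = w}) / real n) \<longlonglongrightarrow> 1"
      by (auto intro!: tendsto_eventually eventually_sequentiallyI[of 1])
    then show ?thesis ..
  next
    case False
    then have "map y [i..<i + length w] \<noteq> w" for i
      unfolding eq .
    then have "(\<lambda>n. real (card {i. i < n \<and> map y [i..<i + length w] = w}) / real n) \<longlonglongrightarrow> 0"
      by simp
    then show ?thesis ..
  qed
qed

section \<open>Densities and the limit of the determinism\<close>

text \<open>Positions are classified by the word of length \<open>k\<close> read there, and a pair
  agrees iff both positions are in the same class. \<open>W\<close> may be any finite superset of
  the occurring words: all words of length \<open>k\<close> serve for the limit, the factors of
  \<open>y\<close> alone for the lower bound.\<close>

lemma agree_pairs_eq_sum_squares:
  assumes W: "finite W" "range (\<lambda>i. map y [i..<i+k]) \<subseteq> W"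
  shows "card (agree_pairs y k n) = (\<Sum>u\<in>W. (card {i. i < n \<and> map y [i..<i+k] = u})\<^sup>2)"
    and "n = (\<Sum>u\<in>W. card {i. i < n \<and> map y [i..<i+k] = u})"
proof -
  define S where "S u = {i. i < n \<and> map y [i..<i+k] = u}" for u
  have fin: "finite (S u)" for u by (simp add: S_def)
  have "agree_pairs y k n = (\<Union>u\<in>W. S u \<times> S u)"
    using W(2) unfolding agree_pairs_def S_def agree_map_iff by auto
  moreover have "card (\<Union>u\<in>W. S u \<times> S u) = (\<Sum>u\<in>W. card (S u \<times> S u))"
    by (rule card_UN_disjoint) (use W fin in \<open>auto simp: S_def\<close>)
  ultimately show "card (agree_pairs y k n) = (\<Sum>u\<in>W. (card {i. i < n \<and> map y [i..<i+k] = u})\<^sup>2)"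
    by (simp add: card_cartesian_product power2_eq_square S_def)
  have "{..<n} = (\<Union>u\<in>W. S u)" using W(2) unfolding S_def by auto
  moreover have "card (\<Union>u\<in>W. S u) = (\<Sum>u\<in>W. card (S u))"
    by (rule card_UN_disjoint) (use W fin in \<open>auto simp: S_def\<close>)
  ultimately show "n = (\<Sum>u\<in>W. card {i. i < n \<and> map y [i..<i+k] = u})"
    unfolding S_def by (metis card_lessThan)
qed

text \<open>The density is the sum of the squared frequencies of the words of length
  \<open>k\<close>, a finite sum of convergent terms.\<close>

lemma agree_density_exists:
  fixes y :: "nat \<Rightarrow> bool"
  assumes "\<And>w. \<exists>p. (\<lambda>n. real (card {i. i < n \<and> map y [i..<i + length w] = w}) / real n) \<longlonglongrightarrow> p"
  shows "\<exists>c. (\<lambda>n. real (card (agree_pairs y k n)) / real n ^ 2) \<longlonglongrightarrow> c"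
proof -
  define p where "p w = lim (\<lambda>n. real (card {i. i < n \<and> map y [i..<i + length w] = w}) / real n)" for w
  have p: "(\<lambda>n. real (card {i. i < n \<and> map y [i..<i + length w] = w}) / real n) \<longlonglongrightarrow> p w" for w
    using assms[of w] unfolding p_def convergent_def[symmetric] convergent_LIMSEQ_iff .
  let ?W = "{u :: bool list. length u = k}"
  have fin: "finite ?W" using finite_lists_length_eq[of "UNIV :: bool set" k] by simp
  have "real (card (agree_pairs y k n)) / real n ^ 2 =
      (\<Sum>u\<in>?W. (real (card {i. i < n \<and> map y [i..<i + length u] = u}) / real n) ^ 2)" for n
  proof -
    have "card (agree_pairs y k n) = (\<Sum>u\<in>?W. (card {i. i < n \<and> map y [i..<i+k] = u})\<^sup>2)"
      by (rule agree_pairs_eq_sum_squares(1)[OF fin]) auto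
    then show ?thesis by (simp add: sum_divide_distrib power_divide)
  qed
  moreover have "(\<lambda>n. \<Sum>u\<in>?W. (real (card {i. i < n \<and> map y [i..<i + length u] = u}) / real n) ^ 2)
      \<longlonglongrightarrow> (\<Sum>u\<in>?W. p u ^ 2)"
    by (intro tendsto_sum tendsto_power p)
  ultimately show ?thesis by auto
qed

text \<open>By Cauchy-Schwarz, spreading \<open>n\<close> positions over at most
  \<open>12 * q * w\<close> words leaves at least \<open>n^2 / (12 * q * w)\<close> agreeing
  pairs.\<close>

lemma agree_density_ge:
  assumes u: "uniform_binary_subst \<zeta> q" and y: "y \<in> subst_shift_space \<zeta>" and w: "1 \<le> w"
    and lim: "(\<lambda>n. real (card (agree_pairs y w n)) / real n ^ 2) \<longlonglongrightarrow> c"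
  shows "1 / (12 * real q * real w) \<le> c"
proof -
  have q: "2 \<le> q" using u by (simp add: uniform_binary_subst_def)
  \<comment> \<open>The least block level reaching \<open>w\<close>; minimality gives
    \<open>q ^ k \<le> q * w\<close>, so the number of factors stays linear in
    \<open>w\<close>.\<close>
  define k where "k = (LEAST k. w \<le> q ^ k)"
  have "w \<le> q ^ w" using less_exp[of w] power_mono[of 2 q w] q by linarith
  then have wk: "w \<le> q ^ k" unfolding k_def by (rule LeastI)
  have qk: "q ^ k \<le> q * w"
  proof (cases k)
    case 0
    then show ?thesis using q w by (simp add: Suc_le_eq)
  next
    case (Suc j)
    then have "\<not> w \<le> q ^ j" using not_less_Least[of j "\<lambda>k. w \<le> q ^ k"] by (simp add: k_def)
    then show ?thesis using Suc by simp
  qed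
  let ?W = "range (\<lambda>i. map y [i..<i+w])"
  note W = card_factors_le[OF u y wk]
  have "1 / (12 * real q * real w) \<le> real (card (agree_pairs y w n)) / real n ^ 2" if n: "1 \<le> n" for n
  proof -
    have "real n = (\<Sum>u\<in>?W. real (card {i. i < n \<and> map y [i..<i+w] = u}))"
      using arg_cong[OF agree_pairs_eq_sum_squares(2)[OF W(1) order_refl, of n], of real]
      by (simp only: of_nat_sum)
    then have "real n ^ 2 = (\<Sum>u\<in>?W. real (card {i. i < n \<and> map y [i..<i+w] = u})) ^ 2"
      by (rule arg_cong[where f = "\<lambda>x. x\<^sup>2"])
    also have "\<dots> \<le> (\<Sum>u\<in>?W. (real (card {i. i < n \<and> map y [i..<i+w] = u}))\<^sup>2) * real (card ?W)"
      by (rule sum_squared_le_sum_of_squares)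
    also have "(\<Sum>u\<in>?W. (real (card {i. i < n \<and> map y [i..<i+w] = u}))\<^sup>2) = real (card (agree_pairs y w n))"
      using agree_pairs_eq_sum_squares(1)[OF W(1) order_refl, of n] by simp
    also have "real (card (agree_pairs y w n)) * real (card ?W) \<le>
        real (card (agree_pairs y w n)) * (12 * real q * real w)"
    proof (rule mult_left_mono)
      have "card ?W \<le> 12 * q * w" using W(2) qk by linarith
      then have "real (card ?W) \<le> real (12 * q * w)" by (rule of_nat_mono)
      then show "real (card ?W) \<le> 12 * real q * real w" by simp
    qed simp
    finally show ?thesis using n q w by (simp add: field_simps)
  qed
  then show ?thesis by (intro LIMSEQ_le_const[OF lim]) auto
qed

text \<open>Errors linear in \<open>n\<close> vanish against \<open>n^2\<close>, and so does the
  change of normalisation from \<open>n^2\<close> to \<open>n^2 - n\<close>. This disposes of all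
  boundary and diagonal terms.\<close>

lemma second_order_tail_limit:
  fixes a b :: "nat \<Rightarrow> real"
  assumes a: "(\<lambda>n. a n / real n ^ 2) \<longlonglongrightarrow> c"
    and diff: "\<And>n. \<bar>b n - a n\<bar> \<le> D * (real n + 1)"
  shows "(\<lambda>n. b n / real n ^ 2) \<longlonglongrightarrow> c" and "(\<lambda>n. b n / (real n ^ 2 - real n)) \<longlonglongrightarrow> c"
proof -
  have inv: "(\<lambda>n. 1 / real n) \<longlonglongrightarrow> 0" by (rule lim_1_over_n)
  have "(\<lambda>n. (b n - a n) / real n ^ 2) \<longlonglongrightarrow> 0"
  proof (rule Lim_null_comparison)
    show "\<forall>\<^sub>F n in sequentially. norm ((b n - a n) / real n ^ 2) \<le> D * (1 / real n + 1 / real n * (1 / real n))"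
      using eventually_gt_at_top[of 0]
    proof eventually_elim
      case (elim n)
      have "\<bar>b n - a n\<bar> / real n ^ 2 \<le> D * (real n + 1) / real n ^ 2"
        using diff by (intro divide_right_mono) auto
      also have "\<dots> = D * (1 / real n + 1 / real n * (1 / real n))"
        using elim by (simp add: field_simps power2_eq_square)
      finally show ?case by simp
    qed
    have "(\<lambda>n. D * (1 / real n + 1 / real n * (1 / real n))) \<longlonglongrightarrow> D * (0 + 0 * 0)"
      by (intro tendsto_intros inv)
    then show "(\<lambda>n. D * (1 / real n + 1 / real n * (1 / real n))) \<longlonglongrightarrow> 0" by simp
  qed
  from tendsto_add[OF a this] show b: "(\<lambda>n. b n / real n ^ 2) \<longlonglongrightarrow> c"
    by (simp add: diff_divide_distrib)
  have "(\<lambda>n. (b n / real n ^ 2) / (1 - 1 / real n)) \<longlonglongrightarrow> c / (1 - 0)"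
    by (intro tendsto_divide tendsto_diff tendsto_const b inv) simp
  moreover have "\<forall>\<^sub>F n in sequentially. (b n / real n ^ 2) / (1 - 1 / real n) = b n / (real n ^ 2 - real n)"
    using eventually_gt_at_top[of 1] by eventually_elim (simp add: field_simps power2_eq_square)
  ultimately show "(\<lambda>n. b n / (real n ^ 2 - real n)) \<longlonglongrightarrow> c"
    using Lim_transform_eventually by fastforce
qed

section \<open>Recurrence quantities expressed by the densities of agreement\<close>

locale agree_density =
  fixes y :: "nat \<Rightarrow> 'a" and C :: "nat \<Rightarrow> real"
  assumes density: "(\<lambda>n. real (card (agree_pairs y k n)) / real n ^ 2) \<longlonglongrightarrow> C k"
begin

definition second_diff :: "nat \<Rightarrow> real" where "second_diff k = C k - 2 * C (Suc k) + C (Suc (Suc k))"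

lemma isolated_density: "(\<lambda>n. real (card (isolated_pairs y k n)) / real n ^ 2) \<longlonglongrightarrow> second_diff k"
proof (rule second_order_tail_limit(1)[OF _ isolated_pairs_near_second_difference])
  have "(\<lambda>n. real (card (agree_pairs y k n)) / real n ^ 2 - 2 * (real (card (agree_pairs y (Suc k) n)) / real n ^ 2)
      + real (card (agree_pairs y (Suc (Suc k)) n)) / real n ^ 2) \<longlonglongrightarrow> second_diff k"
    unfolding second_diff_def by (intro tendsto_intros density)
  then show "(\<lambda>n. (real (card (agree_pairs y k n)) - 2 * real (card (agree_pairs y (Suc k) n))
      + real (card (agree_pairs y (Suc (Suc k)) n))) / real n ^ 2) \<longlonglongrightarrow> second_diff k"
    by (simp add: add_divide_distrib diff_divide_distrib)
qed

text \<open>As a density of isolated pairs it is a limit of nonnegative numbers. This is the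
  convexity of \<open>C\<close>.\<close>

lemma second_diff_nonneg: "0 \<le> second_diff k"
  by (rule LIMSEQ_le_const[OF isolated_density]) auto

lemma C_Suc_le: "C (Suc k) \<le> C k"
proof (rule LIMSEQ_le[OF density density])
  have "card (agree_pairs y (Suc k) n) \<le> card (agree_pairs y k n)" for n
    by (intro card_mono finite_agree_pairs) (auto simp: agree_pairs_def agree_Suc)
  then show "\<exists>N. \<forall>n\<ge>N. real (card (agree_pairs y (Suc k) n)) / real n ^ 2 \<le> real (card (agree_pairs y k n)) / real n ^ 2"
    by (auto intro!: divide_right_mono)
qed

lemma lambda_limit:
  assumes rp: "\<And>i j. rp z \<epsilon> i j \<longleftrightarrow> agree y w i j" and w: "1 \<le> w" and l: "1 \<le> l"
  shows "(\<lambda>n. lambda_l z n \<epsilon> l) \<longlonglongrightarrow> second_diff (w + l - 1)"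
  unfolding lambda_l_def
  by (rule second_order_tail_limit(2)[OF isolated_density lines_near_isolated_pairs[OF rp w l]])

text \<open>The lines of all lengths together cover each off-diagonal recurrence once, and the
  omitted diagonal has only \<open>n\<close> cells.\<close>

lemma RR_1_limit:
  assumes rp: "\<And>i j. rp z \<epsilon> i j \<longleftrightarrow> agree y w i j"
  shows "(\<lambda>n. RR z n \<epsilon> 1) \<longlonglongrightarrow> C w"
proof -
  define R where "R n = {(i, j). i < n \<and> j < n \<and> i \<noteq> j \<and> rp z \<epsilon> i j}" for n
  have RR_eq: "RR z n \<epsilon> 1 = real (card (R n)) / (real n ^ 2 - real n)" for n
  proof -
    have "real (card (R n)) = (\<Sum>l = 1..n. real l * real (N_lines z n \<epsilon> l))"
      unfolding R_def sum_length_N_lines[symmetric] by simp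
    then show ?thesis by (simp add: RR_def lambda_l_def sum_divide_distrib)
  qed
  have "\<bar>real (card (R n)) - real (card (agree_pairs y w n))\<bar> \<le> 1 * (real n + 1)" for n
  proof -
    let ?I = "(\<lambda>i. (i, i)) ` {..<n}"
    have "finite (R n)" by (rule finite_subset[of _ "{..n} \<times> {..n}"]) (auto simp: R_def)
    then have "\<bar>real (card (R n)) - real (card (agree_pairs y w n))\<bar> \<le> real (card ?I)"
      by (intro card_diff_le_of_subset_Un finite_agree_pairs) (auto simp: R_def rp agree_pairs_def)
    also have "card ?I = n" by (subst card_image) (auto simp: inj_on_def)
    also have "real n \<le> 1 * (real n + 1)" by simp
    finally show ?thesis .
  qed
  from second_order_tail_limit(2)[OF density this] show ?thesis unfolding RR_eq .
qed

text \<open>Passing to the complementary sum over the lengths \<open>l < L\<close> keeps the number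
  of terms independent of \<open>n\<close>, so limits can be taken term by term.\<close>

lemma DET_limit:
  assumes rp: "\<And>i j. rp z \<epsilon> i j \<longleftrightarrow> agree y w i j" and w: "1 \<le> w" and pos: "0 < C w" and L: "1 \<le> L"
  shows "(\<lambda>n. DET z n \<epsilon> L) \<longlonglongrightarrow> 1 - (\<Sum>l = 1..<L. real l * second_diff (w + l - 1)) / C w"
proof -
  have "RR z n \<epsilon> L = RR z n \<epsilon> 1 - (\<Sum>l = 1..<L. real l * lambda_l z n \<epsilon> l)" if "L \<le> n" for n
  proof -
    have "{1..n} = {1..<L} \<union> {L..n}" using that L by auto
    moreover have "(\<Sum>l\<in>{1..<L} \<union> {L..n}. real l * lambda_l z n \<epsilon> l) =
        (\<Sum>l = 1..<L. real l * lambda_l z n \<epsilon> l) + (\<Sum>l = L..n. real l * lambda_l z n \<epsilon> l)"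
      by (rule sum.union_disjoint) auto
    ultimately have "RR z n \<epsilon> 1 = (\<Sum>l = 1..<L. real l * lambda_l z n \<epsilon> l) + RR z n \<epsilon> L"
      unfolding RR_def by simp
    then show ?thesis by simp
  qed
  then have "\<forall>\<^sub>F n in sequentially.
      (RR z n \<epsilon> 1 - (\<Sum>l = 1..<L. real l * lambda_l z n \<epsilon> l)) / RR z n \<epsilon> 1 = DET z n \<epsilon> L"
    unfolding DET_def by (intro eventually_sequentiallyI[of L]) simp
  moreover have "(\<lambda>n. (RR z n \<epsilon> 1 - (\<Sum>l = 1..<L. real l * lambda_l z n \<epsilon> l)) / RR z n \<epsilon> 1)
      \<longlonglongrightarrow> (C w - (\<Sum>l = 1..<L. real l * second_diff (w + l - 1))) / C w"
    using pos by (intro tendsto_intros RR_1_limit lambda_limit rp w) auto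
  ultimately show ?thesis
    using pos by (simp add: tendsto_cong diff_divide_distrib)
qed

text \<open>The drops of \<open>C\<close> are nonincreasing and summable, hence \<open>o(1/k)\<close>; so a lower bound of order
  \<open>1/k\<close> on \<open>C\<close> makes them negligible against \<open>C\<close> even when \<open>C\<close> tends to zero.\<close>
lemma relative_drop_limit:
  assumes K: "0 < K" "\<And>k. 1 \<le> k \<Longrightarrow> K / real k \<le> C k"
  shows "(\<lambda>k. (C k - C (Suc k)) / C k) \<longlonglongrightarrow> 0"
proof -
  define d where "d k = C k - C (Suc k)" for k
  have d_nonneg: "0 \<le> d k" for k using C_Suc_le by (simp add: d_def)
  have d_dec: "decseq d"
    by (rule decseq_SucI) (use second_diff_nonneg in \<open>simp add: d_def second_diff_def algebra_simps\<close>)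
  have C_dec: "decseq C" by (rule decseq_SucI) (rule C_Suc_le)
  have C_pos: "0 < C k" if "1 \<le> k" for k
    using K(2)[OF that] K(1) that by (smt (verit) divide_pos_pos of_nat_0_less_iff zero_less_one less_le_trans)
  have C_nonneg: "0 \<le> C k" for k
    using C_pos[of "Suc k"] C_Suc_le[of k] by simp
  obtain c where c: "C \<longlonglongrightarrow> c" "0 \<le> c"
    using decseq_convergent[OF C_dec, of 0] C_nonneg LIMSEQ_le_const by (metis)
  have d0: "d \<longlonglongrightarrow> 0"
    using tendsto_diff[OF c(1) LIMSEQ_Suc[OF c(1)]] unfolding d_def by simp
  show ?thesis
  proof (cases "c = 0")
    case False
    then have "(\<lambda>k. d k / C k) \<longlonglongrightarrow> 0 / c" by (intro tendsto_divide d0 c(1))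
    then show ?thesis by (simp add: d_def)
  next
    case True
    \<comment> \<open>At least half of the drops up to \<open>k\<close> have an index in
      \<open>{h..<k}\<close>; each is at least \<open>d k\<close>, and together they telescope to
      \<open>C h - C k\<close>.\<close>
    have half: "real k * d k \<le> 2 * C (k div 2)" for k
    proof -
      define h where "h = k div 2"
      have h: "h \<le> k" "k \<le> 2 * (k - h)" by (auto simp: h_def)
      have "real (k - h) * d k = (\<Sum>j = h..<k. d k)" by simp
      also have "\<dots> \<le> (\<Sum>j = h..<k. d j)"
        using d_dec by (intro sum_mono) (auto simp: decseq_def)
      also have "\<dots> = C h - C k"
        using sum_Suc_diff'[OF h(1), of "\<lambda>j. - C j"] by (simp add: d_def)
      also have "\<dots> \<le> C h" using C_nonneg by simp
      finally have "real (k - h) * d k \<le> C h" .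
      moreover have "real k * d k \<le> real (2 * (k - h)) * d k"
        using h(2) d_nonneg by (intro mult_right_mono) (auto simp del: of_nat_mult)
      ultimately show ?thesis unfolding h_def[symmetric] by simp
    qed
    have "(\<lambda>k. d k / C k) \<longlonglongrightarrow> 0"
    proof (rule Lim_null_comparison)
      show "\<forall>\<^sub>F k in sequentially. norm (d k / C k) \<le> 2 * C (k div 2) / K"
        using eventually_ge_at_top[of 1]
      proof eventually_elim
        case (elim k)
        \<comment> \<open>The lower bound on \<open>C k\<close> turns division by \<open>C k\<close>
          into multiplication by \<open>k\<close>, which \<open>half\<close> controls.\<close>
        have "d k / C k \<le> d k / (K / real k)"
          using K elim d_nonneg by (intro divide_left_mono mult_pos_pos C_pos) auto
        also have "\<dots> = real k * d k / K" by simp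
        also have "\<dots> \<le> 2 * C (k div 2) / K" using half K(1) by (intro divide_right_mono) auto
        finally show ?case using d_nonneg C_nonneg by simp
      qed
      have "filterlim (\<lambda>k::nat. k div 2) at_top sequentially"
        unfolding filterlim_at_top
      proof
        fix Z :: nat
        show "\<forall>\<^sub>F k in sequentially. Z \<le> k div 2"
          by (rule eventually_sequentiallyI[of "2 * Z"]) auto
      qed
      then have "(\<lambda>k. C (k div 2)) \<longlonglongrightarrow> 0"
        using filterlim_compose[OF c(1)] True by blast
      then have "(\<lambda>k. 2 * C (k div 2) / K) \<longlonglongrightarrow> 2 * 0 / K"
        using K(1) by (intro tendsto_intros) auto
      then show "(\<lambda>k. 2 * C (k div 2) / K) \<longlonglongrightarrow> 0" by simp
    qed
    then show ?thesis by (simp add: d_def)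
  qed
qed

text \<open>Each second difference is at most the drop of \<open>C\<close> at its index, and by
  convexity at most the drop at \<open>w\<close>. So each of the fixed number of terms is negligible
  against \<open>C w\<close>.\<close>

lemma DET_limit_tendsto_1:
  assumes K: "0 < K" "\<And>k. 1 \<le> k \<Longrightarrow> K / real k \<le> C k"
  shows "(\<lambda>w. 1 - (\<Sum>l = 1..<L. real l * second_diff (w + l - 1)) / C w) \<longlonglongrightarrow> 1"
proof -
  have d_dec: "decseq (\<lambda>k. C k - C (Suc k))"
    by (rule decseq_SucI) (use second_diff_nonneg in \<open>simp add: second_diff_def algebra_simps\<close>)
  have "(\<lambda>w. second_diff (w + l - 1) / C w) \<longlonglongrightarrow> 0" if l: "1 \<le> l" for l
  proof (rule tendsto_sandwich[OF _ _ tendsto_const relative_drop_limit[OF K]])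
    have pos: "0 < C w" if "1 \<le> w" for w
      using K(2)[OF that] divide_pos_pos[OF K(1), of "real w"] that by simp
    show "\<forall>\<^sub>F w in sequentially. 0 \<le> second_diff (w + l - 1) / C w"
      using eventually_ge_at_top[of 1]
      by eventually_elim (use pos second_diff_nonneg in \<open>auto intro!: divide_nonneg_pos\<close>)
    show "\<forall>\<^sub>F w in sequentially. second_diff (w + l - 1) / C w \<le> (C w - C (Suc w)) / C w"
      using eventually_ge_at_top[of 1]
    proof eventually_elim
      case (elim w)
      have "second_diff (w + l - 1) \<le> C (w + l - 1) - C (Suc (w + l - 1))"
        using C_Suc_le by (simp add: second_diff_def)
      also have "\<dots> \<le> C w - C (Suc w)"
        using l by (intro decseqD[OF d_dec]) simp
      finally show ?case using pos[OF elim] by (intro divide_right_mono) auto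
    qed
  qed
  then have "(\<lambda>w. 1 - (\<Sum>l = 1..<L. real l * (second_diff (w + l - 1) / C w))) \<longlonglongrightarrow> 1 - (\<Sum>l = 1..<L. real l * 0)"
    by (intro tendsto_intros) auto
  then show ?thesis by (simp add: sum_divide_distrib)
qed

end

theorem theorem1p3:
  fixes \<zeta> :: "bool \<Rightarrow> bool list" and q m L :: nat and y :: "nat \<Rightarrow> bool"
  assumes "uniform_binary_subst \<zeta> q"
    and "y \<in> subst_shift_space \<zeta>"
    and "m \<ge> 1" and "L \<ge> 1"
  shows "(\<forall>\<^sub>F \<epsilon> in at_right 0. convergent (\<lambda>n. DET (embed m y) n \<epsilon> L)) \<and>
         ((\<lambda>\<epsilon>. DET_inf (embed m y) \<epsilon> L) \<longlongrightarrow> 1) (at_right (0::real))"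
proof -
  have "\<exists>C. \<forall>k. (\<lambda>n. real (card (agree_pairs y k n)) / real n ^ 2) \<longlonglongrightarrow> C k"
    by (intro choice allI agree_density_exists word_frequency_exists[OF assms(1,2)])
  then obtain C where C: "\<And>k. (\<lambda>n. real (card (agree_pairs y k n)) / real n ^ 2) \<longlonglongrightarrow> C k"
    by blast
  interpret agree_density y C by unfold_locales (rule C)
  let ?K = "1 / (12 * real q)"
  have K: "0 < ?K" "\<And>k. 1 \<le> k \<Longrightarrow> ?K / real k \<le> C k"
    using assms(1) agree_density_ge[OF assms(1,2) _ C] by (auto simp: uniform_binary_subst_def)
  define G where "G w = 1 - (\<Sum>l = 1..<L. real l * second_diff (w + l - 1)) / C w" for w
  \<comment> \<open>The embedding lengthens the window by \<open>m - 1\<close>: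
    \<open>W \<epsilon>\<close> letters of \<open>y\<close> decide a recurrence of the embedded
    sequence, provided that \<open>window \<epsilon>\<close> is at least 1.\<close>
  define W where "W \<epsilon> = window \<epsilon> + m - 1" for \<epsilon>
  have "\<forall>\<^sub>F \<epsilon> in at_right 0. 1 \<le> window \<epsilon>"
    using window_at_top by (auto simp: filterlim_at_top)
  then have lim: "\<forall>\<^sub>F \<epsilon> in at_right 0. (\<lambda>n. DET (embed m y) n \<epsilon> L) \<longlonglongrightarrow> G (W \<epsilon>)"
    using eventually_at_right_less[of "0::real"]
  proof eventually_elim
    case (elim \<epsilon>)
    have rp: "rp (embed m y) \<epsilon> i j \<longleftrightarrow> agree y (W \<epsilon>) i j" for i j
      using elim assms(3) by (simp add: rp_iff_agree agree_embed W_def)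
    have W: "1 \<le> W \<epsilon>" using elim assms(3) by (simp add: W_def)
    have "0 < ?K / real (W \<epsilon>)" using K(1) W by simp
    then have "0 < C (W \<epsilon>)" using K(2)[OF W] by linarith
    then show ?case unfolding G_def by (intro DET_limit rp W assms(4))
  qed
  have "filterlim W at_top (at_right 0)"
    by (rule filterlim_at_top_mono[OF window_at_top]) (use assms(3) in \<open>auto simp: W_def intro!: always_eventually\<close>)
  moreover have "G \<longlonglongrightarrow> 1" unfolding G_def by (rule DET_limit_tendsto_1[OF K])
  ultimately have "((\<lambda>\<epsilon>. G (W \<epsilon>)) \<longlongrightarrow> 1) (at_right 0)"
    by (rule filterlim_compose[rotated])
  moreover have "\<forall>\<^sub>F \<epsilon> in at_right 0. G (W \<epsilon>) = DET_inf (embed m y) \<epsilon> L"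
    using lim by eventually_elim (simp add: DET_inf_def limI)
  ultimately have "((\<lambda>\<epsilon>. DET_inf (embed m y) \<epsilon> L) \<longlongrightarrow> 1) (at_right 0)"
    by (rule Lim_transform_eventually)
  moreover have "\<forall>\<^sub>F \<epsilon> in at_right 0. convergent (\<lambda>n. DET (embed m y) n \<epsilon> L)"
    using lim by eventually_elim (auto simp: convergent_def)
  ultimately show ?thesis by blast
qed

end
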